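(* There exists a universal constant $C>0$ such that the following holds. Let $m,n\in\mathbb{Z}_{\geq 0}$ with $m\geq n$, and let $f,g$ be eigenfunctions of the Laplace--Beltrami operator $\Delta_{\mathbb{S}^3}$ on the standard three-sphere $\mathbb{S}^3$ such that $$\Delta_{\mathbb{S}^3} f=-m(m+2)f,\qquad \Delta_{\mathbb{S}^3} g=-n(n+2)g.$$ Then $$\|fg\|_{L^2(\mathbb{S}^3)}\leq C\,(n+1)^{\frac12}\|f\|_{L^2(\mathbb{S}^3)}\|g\|_{L^2(\mathbb{S}^3)}.$$
   Context: $\mathbb{S}^3$ is the unit sphere in $\mathbb{R}^4$ with its standard round metric and standard (rotation-invariant) measure. Eigenfunctions are complex-valued. *)

theory Defs
  imports "HOL-Analysis.Analysis"
begin

text \<open>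
  The sphere is \<open>sphere 0 1 \<subseteq> real ^ 'n\<close>; for \<open>'n = 4\<close> this is the three-sphere.  Functions on it are
  total functions on \<open>real ^ 'n\<close> of which only the values on the sphere matter.
\<close>

definition tangent_proj :: "real ^ 'n \<Rightarrow> real ^ 'n \<Rightarrow> real ^ 'n" where
  "tangent_proj p v = v - (p \<bullet> v) *\<^sub>R p"

text \<open>
  The differential of \<open>u\<close> at \<open>p\<close>, extended to all of \<open>real ^ 'n\<close> through the orthogonal projection onto
  the tangent space.  A derivative within the sphere is not unique in the normal direction, but its
  restriction to the tangent space is (\<open>sphere_differential_eq\<close> below).
\<close>

definition sphere_differential ::
    "(real ^ 'n \<Rightarrow> 'b::real_normed_vector) \<Rightarrow> real ^ 'n \<Rightarrow> real ^ 'n \<Rightarrow> 'b" where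
  "sphere_differential u p v =
     frechet_derivative u (at p within sphere 0 1) (tangent_proj p v)"

text \<open>
  The gradient for the induced (round) metric, as a vector of the ambient space: for real \<open>u\<close> it is the
  tangent vector that represents the differential of \<open>u\<close>; for complex \<open>u\<close> it is extended
  complex-linearly.
\<close>

definition sphere_gradient :: "(real ^ 'n \<Rightarrow> complex) \<Rightarrow> real ^ 'n \<Rightarrow> complex ^ 'n" where
  "sphere_gradient u p = (\<chi> i. sphere_differential u p (axis i 1))"

text \<open>
  The divergence of a tangential field \<open>X\<close>.  The Levi-Civita derivative of \<open>X\<close> in a tangent direction
  \<open>v\<close> is the tangential part of the ambient derivative of \<open>X\<close> along \<open>v\<close>, and the divergence is the trace
  over the tangent space at \<open>p\<close> of the endomorphism this defines.  Precomposing with the tangential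
  projection turns that trace into a trace over the ambient space.
\<close>

definition sphere_divergence :: "(real ^ 'n \<Rightarrow> complex ^ 'n) \<Rightarrow> real ^ 'n \<Rightarrow> complex" where
  "sphere_divergence X p = (\<Sum>i\<in>UNIV. sphere_differential X p (axis i 1) $ i)"

definition laplace_beltrami :: "(real ^ 'n \<Rightarrow> complex) \<Rightarrow> real ^ 'n \<Rightarrow> complex" where
  "laplace_beltrami u = sphere_divergence (sphere_gradient u)"

definition C1_on_sphere :: "(real ^ 'n \<Rightarrow> 'b::real_normed_vector) \<Rightarrow> bool" where
  "C1_on_sphere u \<longleftrightarrow> u differentiable_on sphere 0 1 \<and>
     (\<forall>v. continuous_on (sphere 0 1) (\<lambda>p. sphere_differential u p v))"

definition C2_on_sphere :: "(real ^ 'n \<Rightarrow> complex) \<Rightarrow> bool" where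
  "C2_on_sphere u \<longleftrightarrow> C1_on_sphere u \<and> C1_on_sphere (sphere_gradient u)"

text \<open>
  Classical (twice continuously differentiable) solutions of the eigenvalue equation; the zero function
  is admitted.
\<close>

definition sphere_eigenfunction :: "complex \<Rightarrow> (real ^ 'n \<Rightarrow> complex) \<Rightarrow> bool" where
  "sphere_eigenfunction c u \<longleftrightarrow>
     C2_on_sphere u \<and> (\<forall>p\<in>sphere 0 1. laplace_beltrami u p = c * u p)"

text \<open>
  The surface measure in polar coordinates: \<open>\<sigma>(A)\<close> is \<open>n\<close> times the Lebesgue measure of the cone
  \<open>{t x | 0 < t \<le> 1, x \<in> A}\<close>.
\<close>

definition sphere_measure :: "(real ^ 'n) measure" where
  "sphere_measure = scale_measure (of_nat CARD('n))
     (distr (restrict_space lborel (cball 0 1 - {0})) (restrict_space borel (sphere 0 1))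
       (\<lambda>x. x /\<^sub>R norm x))"

definition L2_norm :: "'a measure \<Rightarrow> ('a \<Rightarrow> complex) \<Rightarrow> real" where
  "L2_norm M u = sqrt (LINT x|M. (cmod (u x))\<^sup>2)"

lemma tangent_proj_orthogonal:
  assumes "p \<in> sphere 0 1"
  shows "p \<bullet> tangent_proj p v = 0"
  using assms by (simp add: tangent_proj_def inner_diff_right norm_eq_1)

lemma has_derivative_sphere_unique:
  fixes u :: "real ^ 'n \<Rightarrow> 'b::real_normed_vector"
  assumes p: "p \<in> sphere 0 1" and v: "p \<bullet> v = 0"
    and D: "(u has_derivative D) (at p within sphere 0 1)"
    and E: "(u has_derivative E) (at p within sphere 0 1)"
  shows "D v = E v"
proof (cases "v = 0")
  case True
  then show ?thesis
    using linear_0[OF has_derivative_linear[OF D]] linear_0[OF has_derivative_linear[OF E]] by simp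
next
  case False
  define w where "w = v /\<^sub>R norm v"
  have w: "norm w = 1" "p \<bullet> w = 0" "v = norm v *\<^sub>R w"
    using False v by (auto simp: w_def)
  define \<gamma> where "\<gamma> t = cos t *\<^sub>R p + sin t *\<^sub>R w" for t
  have "p \<bullet> p = 1" "w \<bullet> w = 1"
    using p w by (auto simp: norm_eq_1)
  then have "\<gamma> t \<bullet> \<gamma> t = 1" for t
    using w(2) by (simp add: \<gamma>_def inner_add_left inner_add_right inner_commute
        flip: power2_eq_square)
  then have ran: "range \<gamma> \<subseteq> sphere 0 1"
    by (auto simp: norm_eq_1)
  have \<gamma>0: "\<gamma> 0 = p"
    by (simp add: \<gamma>_def)
  have d\<gamma>: "(\<gamma> has_derivative (\<lambda>t. t *\<^sub>R w)) (at 0)"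
    unfolding \<gamma>_def by (auto intro!: derivative_eq_intros)
  have "(u \<circ> \<gamma> has_derivative F \<circ> (\<lambda>t. t *\<^sub>R w)) (at 0)"
    if "(u has_derivative F) (at p within sphere 0 1)" for F
    using diff_chain_within[OF d\<gamma>, of u F] has_derivative_subset[OF that ran] \<gamma>0 by simp
  from has_derivative_unique[OF this[OF D] this[OF E]] have "D w = E w"
    by (metis comp_apply scaleR_one)
  then show ?thesis
    using w(3) linear_scale[OF has_derivative_linear[OF D]]
      linear_scale[OF has_derivative_linear[OF E]] by metis
qed

lemma sphere_differential_eq:
  assumes "p \<in> sphere 0 1" and "(u has_derivative D) (at p within sphere 0 1)"
  shows "sphere_differential u p v = D (tangent_proj p v)"
  unfolding sphere_differential_def
  by (meson assms has_derivative_sphere_unique tangent_proj_orthogonal differentiableI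
      frechet_derivative_works)

lemma tangent_proj_axis: "tangent_proj p (axis j 1) $ i = (if i = j then 1 else 0) - p $ j * p $ i"
  by (simp add: tangent_proj_def inner_axis) (simp add: axis_def)

lemma sphere_differential_cong:
  assumes "p \<in> sphere 0 1" and "\<And>q. q \<in> sphere 0 1 \<Longrightarrow> u q = w q"
  shows "sphere_differential u p v = sphere_differential w p v"
proof -
  have "(u has_derivative D) (at p within sphere 0 1) \<longleftrightarrow>
        (w has_derivative D) (at p within sphere 0 1)" for D
    by (intro iffI; erule has_derivative_transform[rotated 2]) (use assms in simp_all)
  then show ?thesis
    by (simp add: sphere_differential_def frechet_derivative_def)
qed

text \<open>Normalisation check: the coordinate functions are eigenfunctions with eigenvalue \<open>-(n - 1)\<close>.\<close>

lemma laplace_beltrami_coordinate: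
  fixes p :: "real ^ 'n"
  assumes p: "p \<in> sphere 0 1"
  shows "laplace_beltrami (\<lambda>x. complex_of_real (x $ i)) p =
    - (of_nat CARD('n) - 1) * of_real (p $ i)"
proof -
  let ?X = "\<lambda>q :: real ^ 'n. \<chi> j. complex_of_real ((if i = j then 1 else 0) - q $ j * q $ i)"
  have grad: "sphere_gradient (\<lambda>x. complex_of_real (x $ i)) q = ?X q" if "q \<in> sphere 0 1" for q
  proof -
    have "((\<lambda>x. complex_of_real (x $ i)) has_derivative (\<lambda>x. complex_of_real (x $ i)))
        (at q within sphere 0 1)"
      by (intro bounded_linear_imp_has_derivative bounded_linear_compose[OF bounded_linear_of_real]
          bounded_linear_vec_nth)
    from sphere_differential_eq[OF that this] show ?thesis
      by (simp add: sphere_gradient_def vec_eq_iff tangent_proj_axis)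
  qed
  have dX: "(?X has_derivative
      (\<lambda>h. \<chi> j. complex_of_real (- (p $ j * h $ i + h $ j * p $ i)))) (at p within sphere 0 1)"
    by (subst has_derivative_componentwise_within;
        auto simp: Basis_vec_def inner_axis inner_complex_def Basis_complex_def
          intro!: derivative_eq_intros bounded_linear.has_derivative[OF bounded_linear_vec_nth])
  have pp: "(\<Sum>j\<in>UNIV. p $ j * p $ j) = 1"
    using p by (simp add: norm_eq_1 inner_vec_def)
  have "laplace_beltrami (\<lambda>x. complex_of_real (x $ i)) p
      = (\<Sum>j\<in>UNIV. sphere_differential ?X p (axis j 1) $ j)"
    unfolding laplace_beltrami_def sphere_divergence_def
    using sphere_differential_cong[OF p grad] by simp
  also have "\<dots> = of_real (\<Sum>j\<in>UNIV. - (p $ j * ((if i = j then 1 else 0) - p $ j * p $ i)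
      + (1 - p $ j * p $ j) * p $ i))"
    unfolding of_real_sum
    by (intro sum.cong refl, subst sphere_differential_eq[OF p dX]) (simp add: tangent_proj_axis)
  also have "(\<Sum>j\<in>UNIV. - (p $ j * ((if i = j then 1 else 0) - p $ j * p $ i)
      + (1 - p $ j * p $ j) * p $ i))
      = (\<Sum>j\<in>UNIV. 2 * p $ i * (p $ j * p $ j) - (if i = j then p $ j else 0) - p $ i)"
    by (intro sum.cong refl) (auto simp: algebra_simps)
  also have "\<dots> = - (real CARD('n) - 1) * p $ i"
    unfolding sum_subtractf sum_distrib_left[symmetric] pp by (simp add: algebra_simps)
  finally show ?thesis
    by simp
qed

lemma measurable_sphere_retraction:
  "(\<lambda>x::real ^ 'n. x /\<^sub>R norm x)
     \<in> restrict_space lborel (cball 0 1 - {0}) \<rightarrow>\<^sub>M restrict_space borel (sphere 0 1)"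
  by (intro measurable_restrict_space2 measurable_restrict_space1)
    (auto simp: space_restrict_space)

lemma emeasure_sphere_measure:
  fixes A :: "(real ^ 'n) set"
  assumes A: "A \<in> sets borel" "A \<subseteq> sphere 0 1"
  shows "emeasure sphere_measure A =
    of_nat CARD('n) * emeasure lborel {t *\<^sub>R x | t x. 0 < t \<and> t \<le> 1 \<and> x \<in> A}"
proof -
  let ?K = "cball 0 1 - {0 :: real ^ 'n}"
  have "A \<in> sets (restrict_space borel (sphere 0 1))"
    using A by (auto simp: sets_restrict_space_iff)
  then have "emeasure sphere_measure A = of_nat CARD('n) *
      emeasure (restrict_space lborel ?K)
        ((\<lambda>x. x /\<^sub>R norm x) -` A \<inter> space (restrict_space lborel ?K))"
    by (simp add: sphere_measure_def emeasure_distr[OF measurable_sphere_retraction])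
  also have "(\<lambda>x. x /\<^sub>R norm x) -` A \<inter> space (restrict_space lborel ?K) =
      {t *\<^sub>R x | t x. 0 < t \<and> t \<le> 1 \<and> x \<in> A}" (is "?L = ?R")
  proof (intro equalityI subsetI)
    fix y assume "y \<in> ?L"
    then have "y = norm y *\<^sub>R (y /\<^sub>R norm y)" "0 < norm y" "norm y \<le> 1" "y /\<^sub>R norm y \<in> A"
      by (auto simp: space_restrict_space)
    then show "y \<in> ?R" by blast
  next
    fix y assume "y \<in> ?R"
    then show "y \<in> ?L"
      using A(2) by (force simp: space_restrict_space)
  qed
  also have "emeasure (restrict_space lborel ?K) ?R = emeasure lborel ?R"
    using A(2) by (intro emeasure_restrict_space) force+
  finally show ?thesis .
qed

text \<open>Normalisation check: the total mass is the surface area, for the three-sphere \<open>2 \<pi>\<^sup>2\<close>.\<close>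

lemma emeasure_sphere_measure_space:
  "emeasure (sphere_measure :: (real ^ 4) measure) (sphere 0 1) = ennreal (2 * pi\<^sup>2)"
proof -
  have "{t *\<^sub>R x | t x. 0 < t \<and> t \<le> 1 \<and> x \<in> sphere 0 1} = cball 0 1 - {0 :: real ^ 4}" (is "?R = ?K")
  proof (intro equalityI subsetI)
    fix y assume "y \<in> ?K"
    then have "y = norm y *\<^sub>R (y /\<^sub>R norm y)" "0 < norm y" "norm y \<le> 1" "y /\<^sub>R norm y \<in> sphere 0 1"
      by auto
    then show "y \<in> ?R" by blast
  qed force
  moreover have "emeasure lborel (cball 0 1 - {0 :: real ^ 4}) = emeasure lborel (cball (0 :: real ^ 4) 1)"
    by (intro emeasure_Diff_null_set) auto
  moreover have "\<dots> = ennreal (pi\<^sup>2 / 2)"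
    by (simp add: emeasure_cball unit_ball_vol_numeral eval_nat_numeral)
  ultimately show ?thesis
    by (simp add: emeasure_sphere_measure flip: ennreal_numeral ennreal_mult)
qed

end

theory Submission
  imports Defs
begin

text \<open>
  Writing \<open>|f|\<^sup>2 = (Re f)\<^sup>2 + (Im f)\<^sup>2\<close> and likewise for \<open>g\<close> expands \<open>|f g|\<^sup>2\<close> into four squares of
  products of real eigenfunctions, so it is enough to bound \<open>\<integral> f\<^sup>2 g\<^sup>2\<close> for real \<open>f\<close>, \<open>g\<close> of degrees
  \<open>m \<ge> n\<close>, with respect to the rotation-invariant probability measure.

  Let \<open>U\<^sub>l\<close> be the Chebyshev polynomials of the second kind.  Integration against the zonal kernel
  \<open>(l + 1) U\<^sub>l(x \<bullet> y)\<close> is the orthogonal projection \<open>P\<^sub>l\<close> onto the eigenspace of degree \<open>l\<close>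
  (\<open>eigenfn_reproducing\<close>).  Compose the map \<open>f \<otimes> g \<mapsto> f g\<close>, restricted to degrees \<open>m\<close> and \<open>n\<close>, with its
  adjoint: the result has the product of the two kernels as its kernel.  Since
  \<open>U\<^sub>m U\<^sub>n = \<Sum>k\<le>n. U\<^bsub>m+n-2k\<^esub>\<close>, it acts on degree \<open>l\<close> as multiplication by
  \<open>(m + 1)(n + 1) / (l + 1)\<close> for the degrees \<open>l = m + n - 2k\<close>, and as \<open>0\<close> otherwise.  This is
  \<open>bilinear_duality\<close>.

  If \<open>2n \<le> m + 1\<close>, every such \<open>l\<close> satisfies \<open>l + 1 \<ge> (m + 1) / 2\<close>, the multiplier is at most
  \<open>2(n + 1)\<close>, and the estimate follows (\<open>bilinear_separated\<close>).

  Otherwise \<open>m + 2 \<le> 2n\<close>, the degrees are comparable, and by the Cauchy-Schwarz inequality it suffices that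
  \<open>\<integral> f\<^sup>4 \<le> C (m + 1) (\<integral> f\<^sup>2)\<^sup>2\<close>.  Low degrees \<open>l\<close> now occur in \<open>f\<^sup>2\<close>, where the
  multiplier is large, and duality alone gives only \<open>(m + 1)\<^sup>2\<close> in place of \<open>m + 1\<close>.  But the
  fourth moment can be computed with weights that suppress the low degrees: by partial integration,
  \<open>4 m (m + 2) \<integral> f\<^sup>4 = 3 \<integral> |\<nabla>(f\<^sup>2)|\<^sup>2 = 3 (\<Sum>l. l (l + 2) \<parallel>P\<^sub>l (f\<^sup>2)\<parallel>\<^sup>2)\<close>
  (\<open>fourth_moment_identity\<close>).  The weight is at most \<open>(l + 1)\<^sup>2\<close>; one of its factors \<open>l + 1\<close> is bounded by
  \<open>2m + 1\<close>, and the other one is exactly what the duality estimate can absorb (\<open>square_weighted_spectrum\<close>).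

  The Laplacian enters as a sum of three second derivatives along one-parameter groups of rotations,
  the left multiplications by \<open>exp(t i)\<close>, \<open>exp(t j)\<close> and \<open>exp(t k)\<close> on the unit quaternions.
  Integration by parts is then nothing but the invariance of the measure.
\<close>

section \<open>The normalised surface measure\<close>

abbreviation S3 :: "(real ^ 4) set" where "S3 \<equiv> sphere 0 1"

definition round_prob :: "(real ^ 4) measure" where
  "round_prob = density sphere_measure (\<lambda>_. ennreal (1 / (2 * pi\<^sup>2)))"

lemma sets_sphere_measure: "sets (sphere_measure :: (real ^ 4) measure) = sets (restrict_space borel S3)"
  by (simp add: sphere_measure_def)

lemma sets_round_prob [measurable_cong]: "sets round_prob = sets (restrict_space borel S3)"
  by (simp add: round_prob_def sets_sphere_measure)

lemma space_round_prob [simp]: "space round_prob = S3"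
  using sets_eq_imp_space_eq[OF sets_round_prob] by (simp add: space_restrict_space)

lemma sets_round_prob_iff: "A \<in> sets round_prob \<longleftrightarrow> A \<subseteq> S3 \<and> A \<in> sets borel"
  by (auto simp: sets_round_prob sets_restrict_space_iff)

lemma emeasure_round_prob:
  assumes "A \<in> sets round_prob"
  shows "emeasure round_prob A =
    ennreal (2 / pi\<^sup>2) * emeasure lborel {t *\<^sub>R x | t x. 0 < t \<and> t \<le> 1 \<and> x \<in> A}"
proof -
  have "emeasure round_prob A = ennreal (1 / (2 * pi\<^sup>2)) * emeasure sphere_measure A"
    unfolding round_prob_def using assms
    by (subst emeasure_density_const) (auto simp: round_prob_def)
  also have "emeasure sphere_measure A = of_nat CARD(4) *
      emeasure lborel {t *\<^sub>R x | t x. 0 < t \<and> t \<le> 1 \<and> x \<in> A}"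
    using assms by (intro emeasure_sphere_measure) (auto simp: sets_round_prob_iff)
  also have "ennreal (1 / (2 * pi\<^sup>2)) * (of_nat CARD(4) *
      emeasure lborel {t *\<^sub>R x | t x. 0 < t \<and> t \<le> 1 \<and> x \<in> A}) =
      ennreal (2 / pi\<^sup>2) * emeasure lborel {t *\<^sub>R x | t x. 0 < t \<and> t \<le> 1 \<and> x \<in> A}"
    by (simp add: mult.assoc[symmetric] flip: ennreal_numeral ennreal_mult)
  finally show ?thesis .
qed

lemma emeasure_round_prob_S3: "emeasure round_prob S3 = 1"
proof -
  have "emeasure round_prob S3 = ennreal (1 / (2 * pi\<^sup>2)) * emeasure sphere_measure S3"
    unfolding round_prob_def
    by (subst emeasure_density_const) (auto simp: sets_sphere_measure sets_restrict_space_iff)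
  also have "\<dots> = 1"
    by (simp add: emeasure_sphere_measure_space flip: ennreal_mult)
  finally show ?thesis .
qed

interpretation round_prob: finite_measure round_prob
  by standard (simp add: emeasure_round_prob_S3)

lemma measure_round_prob_S3 [simp]: "measure round_prob S3 = 1"
  by (simp add: measure_def emeasure_round_prob_S3)

interpretation round_prob2: pair_sigma_finite round_prob round_prob ..

lemma integral_sphere_measure:
  fixes u :: "real ^ 4 \<Rightarrow> real"
  assumes "u \<in> borel_measurable round_prob"
  shows "(LINT x|sphere_measure. u x) = 2 * pi\<^sup>2 * (LINT x|round_prob. u x)"
proof -
  have "u \<in> borel_measurable sphere_measure"
    using assms by (simp add: round_prob_def)
  then have "(LINT x|round_prob. u x) = (LINT x|sphere_measure. 1 / (2 * pi\<^sup>2) * u x)"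
    unfolding round_prob_def by (subst integral_real_density) auto
  then show ?thesis by simp
qed

text \<open>
  The cone over \<open>C\<close> is the preimage of \<open>C\<close> under the radial retraction of the punctured ball.
\<close>

lemma cone_borel:
  fixes C :: "(real ^ 4) set"
  assumes that: "C \<in> sets round_prob"
  shows "{t *\<^sub>R x | t x. 0 < t \<and> t \<le> 1 \<and> x \<in> C} \<in> sets borel" (is "?R \<in> _")
proof -
  have C: "C \<in> sets (restrict_space borel S3)" using that by (simp add: sets_round_prob)
  have "(\<lambda>x. x /\<^sub>R norm x) -` C \<inter> space (restrict_space lborel (cball 0 1 - {0}))
      \<in> sets (restrict_space lborel (cball (0 :: real ^ 4) 1 - {0}))"
    by (rule measurable_sets[OF measurable_sphere_retraction C])
  also have "(\<lambda>x. x /\<^sub>R norm x) -` C \<inter> space (restrict_space lborel (cball 0 1 - {0})) = ?R"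
    (is "?L = _")
  proof (intro equalityI subsetI)
    fix y assume "y \<in> ?L"
    then have "y = norm y *\<^sub>R (y /\<^sub>R norm y)" "0 < norm y" "norm y \<le> 1" "y /\<^sub>R norm y \<in> C"
      by (auto simp: space_restrict_space)
    then show "y \<in> ?R" by blast
  next
    fix y assume "y \<in> ?R"
    then show "y \<in> ?L"
      using that by (force simp: space_restrict_space sets_round_prob_iff)
  qed
  finally show ?thesis
    by (subst (asm) sets_restrict_space_iff) auto
qed

lemma emeasure_lborel_orthogonal_image:
  fixes T :: "real ^ 'n::{finite,wellorder} \<Rightarrow> real ^ 'n::_"
  assumes T: "orthogonal_transformation T" and A: "A \<in> sets borel" "T ` A \<in> sets borel" "bounded A"
  shows "emeasure lborel (T ` A) = emeasure lborel A"
proof -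
  have A': "A \<in> lmeasurable"
    using A(1,3) by (intro bounded_set_imp_lmeasurable) auto
  have "emeasure lebesgue (T ` A) = emeasure lebesgue A"
    using A' measure_orthogonal_image[OF T A'] measurable_orthogonal_image[OF T A']
    by (simp add: emeasure_eq_measure2)
  then show ?thesis
    using A by simp
qed

text \<open>
  The measure of \<open>A\<close> is a multiple of the Lebesgue measure of the cone over \<open>A\<close>, and an orthogonal map
  carries cones over subsets of the sphere to such cones while preserving Lebesgue measure.
\<close>

lemma integral_orthogonal:
  fixes u :: "real ^ 4 \<Rightarrow> real"
  assumes T: "orthogonal_transformation T" and u: "u \<in> borel_measurable round_prob"
  shows "(LINT p|round_prob. u (T p)) = (LINT p|round_prob. u p)"
proof -
  have TS: "T p \<in> S3 \<longleftrightarrow> p \<in> S3" for p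
    using orthogonal_transformation_norm[OF T] by simp
  have contT: "continuous_on A T" for A
    by (simp add: T linear_continuous_on linear_linear orthogonal_transformation_linear)
  have mT: "T \<in> round_prob \<rightarrow>\<^sub>M round_prob"
    unfolding measurable_cong_sets[OF sets_round_prob sets_round_prob]
    by (intro measurable_restrict_space2 measurable_restrict_space1 borel_measurable_continuous_onI contT)
       (auto simp: space_restrict_space TS orthogonal_transformation_norm[OF T])
  have "distr round_prob round_prob T = round_prob"
  proof (rule measure_eqI)
    fix A assume "A \<in> sets (distr round_prob round_prob T)"
    then have A: "A \<in> sets round_prob" by simp
    let ?cone = "\<lambda>A. {t *\<^sub>R x | t x. 0 < t \<and> t \<le> 1 \<and> x \<in> A}"
    let ?B = "T -` A \<inter> space round_prob"
    have B: "?B \<in> sets round_prob" using mT A by (rule measurable_sets)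
    have TB: "T ` ?B = A"
    proof
      show "A \<subseteq> T ` ?B"
      proof
        fix y assume y: "y \<in> A"
        obtain x where "y = T x" using orthogonal_transformation_surj[OF T] by (metis surjD)
        then show "y \<in> T ` ?B" using y A TS by (auto simp: sets_round_prob_iff)
      qed
    qed auto
    have cone: "T ` ?cone ?B = ?cone (T ` ?B)"
      using linear_cmul[OF orthogonal_transformation_linear[OF T]] by (fastforce simp: image_iff)
    have bdd: "bounded (?cone ?B)"
      by (rule boundedI[of _ 1]) auto
    have "emeasure lborel (?cone ?B) = emeasure lborel (T ` ?cone ?B)"
      by (rule emeasure_lborel_orthogonal_image[symmetric, OF T cone_borel[OF B] _ bdd])
        (unfold cone TB, rule cone_borel[OF A])
    also have "\<dots> = emeasure lborel (?cone A)"
      unfolding cone TB ..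
    finally show "emeasure (distr round_prob round_prob T) A = emeasure round_prob A"
      by (simp only: emeasure_distr[OF mT A] emeasure_round_prob[OF A] emeasure_round_prob[OF B])
  qed simp
  then show ?thesis
    using integral_distr[OF mT u] by metis
qed

lemma integrable_round_prob:
  fixes u :: "real ^ 4 \<Rightarrow> real"
  assumes "continuous_on S3 u"
  shows "integrable round_prob u"
proof -
  have "u \<in> borel_measurable round_prob"
    unfolding measurable_cong_sets[OF sets_round_prob refl]
    by (rule borel_measurable_continuous_on_restrict[OF assms])
  moreover obtain B where "\<forall>y\<in>u ` S3. norm y \<le> B"
    using compact_imp_bounded[OF compact_continuous_image[OF assms compact_sphere]]
    unfolding bounded_iff by blast
  ultimately show ?thesis
    by (intro round_prob.integrable_const_bound[of _ B]) auto
qed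

lemma integral_round_prob_cong:
  "(\<And>x. x \<in> S3 \<Longrightarrow> u x = v x) \<Longrightarrow> (LINT x|round_prob. u x) = (LINT x|round_prob. v x)"
  by (rule Bochner_Integration.integral_cong) auto

lemma continuous_on_integral_round_prob:
  fixes F :: "'a::metric_space \<Rightarrow> real ^ 4 \<Rightarrow> real"
  assumes A: "compact A" and F: "continuous_on (A \<times> S3) (\<lambda>(a, x). F a x)"
  shows "continuous_on A (\<lambda>a. LINT x|round_prob. F a x)"
proof (rule continuous_on_sequentiallyI)
  fix s a assume s: "\<forall>n. s n \<in> A" "a \<in> A" "s \<longlonglongrightarrow> a"
  have cx: "continuous_on S3 (F b)" if "b \<in> A" for b
  proof -
    have "continuous_on S3 (\<lambda>x. case (b, x) of (a, x) \<Rightarrow> F a x)"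
      by (rule continuous_on_compose2[OF F]) (use that in \<open>auto intro!: continuous_intros\<close>)
    then show ?thesis by simp
  qed
  have ca: "continuous_on A (\<lambda>b. F b x)" if "x \<in> S3" for x
  proof -
    have "continuous_on A (\<lambda>b. case (b, x) of (a, x) \<Rightarrow> F a x)"
      by (rule continuous_on_compose2[OF F]) (use that in \<open>auto intro!: continuous_intros\<close>)
    then show ?thesis by simp
  qed
  obtain B where B: "\<forall>y\<in>(\<lambda>(a, x). F a x) ` (A \<times> S3). norm y \<le> B"
    using compact_imp_bounded[OF compact_continuous_image[OF F compact_Times[OF A compact_sphere]]]
    unfolding bounded_iff by blast
  show "(\<lambda>n. LINT x|round_prob. F (s n) x) \<longlonglongrightarrow> (LINT x|round_prob. F a x)"
  proof (rule integral_dominated_convergence[where w = "\<lambda>_. B"])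
    show "AE x in round_prob. (\<lambda>n. F (s n) x) \<longlonglongrightarrow> F a x"
      using ca s by (auto simp: continuous_on_sequentially o_def)
  qed (use s B cx integrable_round_prob in auto)
qed

lemma Fubini_round_prob:
  fixes F :: "real ^ 4 \<Rightarrow> real ^ 4 \<Rightarrow> real"
  assumes F: "continuous_on (S3 \<times> S3) (\<lambda>(x, y). F x y)"
  shows "(LINT x|round_prob. LINT y|round_prob. F x y) = (LINT y|round_prob. LINT x|round_prob. F x y)"
proof -
  interpret P: finite_measure "round_prob \<Otimes>\<^sub>M round_prob"
    by (rule finite_measure_pair_measure) unfold_locales
  let ?G = "\<lambda>z. indicator (S3 \<times> S3) z *\<^sub>R (\<lambda>(x, y). F x y) z"
  have id: "(\<lambda>x. x) \<in> round_prob \<rightarrow>\<^sub>M borel"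
    by (rule borel_measurable_continuous_on_restrict[of S3 "\<lambda>x. x", folded measurable_cong_sets[OF sets_round_prob refl]]) auto
  have "?G \<in> borel_measurable borel"
    by (intro borel_measurable_continuous_on_indicator F) (auto intro!: borel_closed closed_Times)
  then have "?G \<in> borel_measurable (borel \<Otimes>\<^sub>M borel)"
    by (simp add: borel_prod)
  moreover have "(\<lambda>z. (fst z, snd z)) \<in> round_prob \<Otimes>\<^sub>M round_prob \<rightarrow>\<^sub>M borel \<Otimes>\<^sub>M borel"
    by (intro measurable_Pair measurable_compose[OF measurable_fst id] measurable_compose[OF measurable_snd id])
  ultimately have "?G \<in> borel_measurable (round_prob \<Otimes>\<^sub>M round_prob)"
    using measurable_compose by force
  then have "(\<lambda>(x, y). F x y) \<in> borel_measurable (round_prob \<Otimes>\<^sub>M round_prob)"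
    by (rule measurable_cong[THEN iffD1, rotated]) (auto simp: space_pair_measure)
  moreover obtain B where "\<forall>y\<in>(\<lambda>(x, y). F x y) ` (S3 \<times> S3). norm y \<le> B"
    using compact_imp_bounded[OF compact_continuous_image[OF F compact_Times[OF compact_sphere compact_sphere]]]
    unfolding bounded_iff by blast
  ultimately have "integrable (round_prob \<Otimes>\<^sub>M round_prob) (\<lambda>(x, y). F x y)"
    by (intro P.integrable_const_bound[of _ B]) (auto simp: space_pair_measure)
  from round_prob2.Fubini_integral[OF this] show ?thesis by simp
qed

lemma integral_round_prob_Cauchy_Schwarz:
  fixes u v :: "real ^ 4 \<Rightarrow> real"
  assumes u: "continuous_on S3 u" and v: "continuous_on S3 v"
  shows "(LINT p|round_prob. u p * v p)\<^sup>2 \<le> (LINT p|round_prob. (u p)\<^sup>2) * (LINT p|round_prob. (v p)\<^sup>2)"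
proof -
  define A B C where "A = (LINT p|round_prob. (u p)\<^sup>2)" and "B = (LINT p|round_prob. u p * v p)"
    and "C = (LINT p|round_prob. (v p)\<^sup>2)"
  have quad: "s\<^sup>2 * A - 2 * s * t * B + t\<^sup>2 * C \<ge> 0" for s t
  proof -
    have "0 \<le> (LINT p|round_prob. (s * u p - t * v p)\<^sup>2)" by simp
    also have "\<dots> = (LINT p|round_prob. s\<^sup>2 * (u p)\<^sup>2 - 2 * s * t * (u p * v p) + t\<^sup>2 * (v p)\<^sup>2)"
      by (simp add: power2_eq_square algebra_simps)
    also have "\<dots> = s\<^sup>2 * A - 2 * s * t * B + t\<^sup>2 * C"
      unfolding A_def B_def C_def
      by (subst Bochner_Integration.integral_add Bochner_Integration.integral_diff integral_mult_right_zero;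
          (intro integrable_round_prob continuous_intros u v)?)+ simp
    finally show ?thesis .
  qed
  have C0: "C \<ge> 0" by (simp add: C_def)
  have "B\<^sup>2 \<le> A * C"
  proof (cases "C = 0")
    case True
    have "B = 0"
    proof (rule ccontr)
      assume "B \<noteq> 0"
      with quad[of 1 "(A + 1) / (2 * B)"] True show False by simp
    qed
    then show ?thesis by (simp add: True)
  next
    case False
    have "0 \<le> C * (A * C - B\<^sup>2)"
      using quad[of C B] by (simp add: power2_eq_square algebra_simps)
    then show ?thesis using C0 False by (simp add: zero_le_mult_iff)
  qed
  then show ?thesis by (simp add: A_def B_def C_def)
qed


section \<open>Chebyshev polynomials of the second kind\<close>

text \<open>
  \<open>cheb n\<close> is the Chebyshev polynomial \<open>U\<^sub>n\<close>, characterised by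
  \<open>sin \<theta> * U\<^sub>n(cos \<theta>) = sin ((n + 1) \<theta>)\<close>; as a function on the unit quaternions, \<open>x \<mapsto> U\<^sub>n(Re x)\<close>
  is the character of the irreducible representation of dimension \<open>n + 1\<close>.
\<close>

fun cheb :: "nat \<Rightarrow> real poly" where
  "cheb 0 = 1"
| "cheb (Suc 0) = 2 * [:0, 1:]"
| "cheb (Suc (Suc n)) = 2 * [:0, 1:] * cheb (Suc n) - cheb n"

text \<open>
  The algebra of the induction step in \<open>cheb_derivative\<close>, with \<open>u\<close>, \<open>v\<close> for two consecutive Chebyshev
  polynomials, \<open>u'\<close>, \<open>v'\<close> for their derivatives and \<open>c\<close> for the index.
\<close>

lemma cheb_derivative_step:
  fixes x u u' v v' c :: "'a::comm_ring_1"
  assumes B: "(1 - x\<^sup>2) * u' = (c + 2) * x * u - (c + 1) * v" and C: "v' = x * u' + (c + 2) * u"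
  shows "2 * v + 2 * x * v' - u' = x * v' + (c + 3) * v"
    and "(1 - x\<^sup>2) * v' = (c + 3) * x * v - (c + 2) * (2 * x * v - u)"
proof -
  have "(c + 1) * v = x * v' - u'"
    using B C by (simp add: algebra_simps power2_eq_square)
  then have "x * v' + (c + 3) * v = x * v' + (x * v' - u') + 2 * v"
    by (simp add: algebra_simps)
  then show "2 * v + 2 * x * v' - u' = x * v' + (c + 3) * v"
    by (simp add: algebra_simps)
  have "(1 - x\<^sup>2) * v' = x * ((1 - x\<^sup>2) * u') + (c + 2) * (1 - x\<^sup>2) * u"
    unfolding C by (simp add: algebra_simps)
  also have "\<dots> = (c + 3) * x * v - (c + 2) * (2 * x * v - u)"
    unfolding B by (simp add: algebra_simps power2_eq_square)
  finally show "(1 - x\<^sup>2) * v' = (c + 3) * x * v - (c + 2) * (2 * x * v - u)" .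
qed

text \<open>
  Each relation for \<open>Suc n\<close> needs both relations for \<open>n\<close>, hence the simultaneous induction.
\<close>

lemma cheb_derivative:
  "(1 - [:0, 1:]\<^sup>2) * pderiv (cheb n) =
     (of_nat n + 2) * [:0, 1:] * cheb n - (of_nat n + 1) * cheb (Suc n) \<and>
   pderiv (cheb (Suc n)) = [:0, 1:] * pderiv (cheb n) + (of_nat n + 2) * cheb n"
proof (induction n)
  case 0
  show ?case
    by (simp add: pderiv_mult pderiv_pCons algebra_simps numeral_poly one_pCons)
next
  case (Suc n)
  let ?X = "[:0, 1:] :: real poly"
  have B: "(1 - ?X\<^sup>2) * pderiv (cheb n) =
     (of_nat n + 2) * ?X * cheb n - (of_nat n + 1) * cheb (Suc n)"
    and C: "pderiv (cheb (Suc n)) = ?X * pderiv (cheb n) + (of_nat n + 2) * cheb n"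
    using Suc.IH by auto
  have X: "pderiv ?X = 1" by (simp add: pderiv_pCons)
  have "pderiv (cheb (Suc (Suc n))) =
      2 * cheb (Suc n) + 2 * ?X * pderiv (cheb (Suc n)) - pderiv (cheb n)"
    by (simp del: mult_pCons_left mult_pCons_right add: pderiv_mult pderiv_diff X algebra_simps)
  also have "\<dots> = ?X * pderiv (cheb (Suc n)) + (of_nat n + 3) * cheb (Suc n)"
    by (rule cheb_derivative_step(1)[OF B C])
  finally have 1: "pderiv (cheb (Suc (Suc n))) = ?X * pderiv (cheb (Suc n)) + (of_nat n + 3) * cheb (Suc n)" .
  have 2: "(1 - ?X\<^sup>2) * pderiv (cheb (Suc n)) =
      (of_nat n + 3) * ?X * cheb (Suc n) - (of_nat n + 2) * (2 * ?X * cheb (Suc n) - cheb n)"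
    by (rule cheb_derivative_step(2)[OF B C])
  have c: "of_nat (Suc n) + 2 = (of_nat n + 3 :: real poly)" "of_nat (Suc n) + 1 = (of_nat n + 2 :: real poly)"
    by simp_all
  show ?case
    unfolding c by (intro conjI) (subst cheb.simps(3), rule 2, rule 1)
qed

text \<open>
  Differentiating the first relation of \<open>cheb_derivative\<close> and eliminating the derivative of
  \<open>cheb (Suc n)\<close> by the second one.  The left-hand side is the Laplacian of \<open>x \<mapsto> U\<^sub>n(x \<bullet> p)\<close> at
  \<open>t = x \<bullet> p\<close>, see \<open>has_laplacian_zonal_cheb\<close>.
\<close>

lemma cheb_ode:
  "(1 - t\<^sup>2) * poly (pderiv (pderiv (cheb n))) t - 3 * t * poly (pderiv (cheb n)) t =
     - (real n * (real n + 2)) * poly (cheb n) t"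
proof -
  let ?X = "[:0, 1:] :: real poly"
  have B: "(1 - ?X\<^sup>2) * pderiv (cheb n) =
     (of_nat n + 2) * ?X * cheb n - (of_nat n + 1) * cheb (Suc n)"
    and C: "pderiv (cheb (Suc n)) = ?X * pderiv (cheb n) + (of_nat n + 2) * cheb n"
    using cheb_derivative by auto
  have P: "pderiv (of_nat k :: real poly) = 0" for k
    by (simp add: of_nat_poly)
  have "poly (pderiv ((1 - ?X\<^sup>2) * pderiv (cheb n))) t =
      poly (pderiv ((of_nat n + 2) * ?X * cheb n - (of_nat n + 1) * cheb (Suc n))) t"
    by (simp only: B)
  then have "(1 - t\<^sup>2) * poly (pderiv (pderiv (cheb n))) t - 2 * t * poly (pderiv (cheb n)) t =
      (real n + 2) * (poly (cheb n) t + t * poly (pderiv (cheb n)) t)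
      - (real n + 1) * poly (pderiv (cheb (Suc n))) t"
    by (simp del: mult_pCons_left mult_pCons_right
        add: pderiv_mult pderiv_diff pderiv_add power2_eq_square pderiv_pCons P algebra_simps)
  moreover have "poly (pderiv (cheb (Suc n))) t = t * poly (pderiv (cheb n)) t + (real n + 2) * poly (cheb n) t"
    by (simp add: C)
  ultimately show ?thesis by algebra
qed

lemma cheb_at_1: "poly (cheb n) 1 = real n + 1"
  by (induction n rule: cheb.induct) auto

text \<open>
  The Clebsch-Gordan rule for the characters, by induction on \<open>n\<close>: multiplication by \<open>2t\<close> sends \<open>U\<^sub>j\<close>
  to \<open>U\<^bsub>j+1\<^esub> + U\<^bsub>j-1\<^esub>\<close>.
\<close>

lemma cheb_mult:
  assumes "n \<le> m"
  shows "cheb m * cheb n = (\<Sum>k\<le>n. cheb (m + n - 2 * k))"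
  using assms
proof (induction n rule: cheb.induct)
  case 1
  show ?case by simp
next
  case 2
  then obtain k where "m = Suc k" by (cases m) auto
  then show ?case by (simp del: mult_pCons_left mult_pCons_right)
next
  case (3 n)
  let ?X = "[:0, 1:] :: real poly"
  have "cheb m * cheb (Suc (Suc n)) = 2 * ?X * (cheb m * cheb (Suc n)) - cheb m * cheb n"
    by (simp del: mult_pCons_left mult_pCons_right add: algebra_simps)
  also have "\<dots> = (\<Sum>k\<le>Suc n. 2 * ?X * cheb (m + Suc n - 2 * k)) - (\<Sum>k\<le>n. cheb (m + n - 2 * k))"
    using 3 by (simp only: sum_distrib_left)
  also have "(\<Sum>k\<le>Suc n. 2 * ?X * cheb (m + Suc n - 2 * k)) =
      (\<Sum>k\<le>Suc n. cheb (m + Suc (Suc n) - 2 * k) + cheb (m + n - 2 * k))"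
  proof (rule sum.cong[OF refl])
    fix k assume "k \<in> {..Suc n}"
    define j where "j = m + n - 2 * k"
    have "m + Suc n - 2 * k = Suc j" "m + Suc (Suc n) - 2 * k = Suc (Suc j)"
      using \<open>k \<in> {..Suc n}\<close> 3 by (auto simp: j_def)
    then show "2 * ?X * cheb (m + Suc n - 2 * k) = cheb (m + Suc (Suc n) - 2 * k) + cheb (m + n - 2 * k)"
      unfolding j_def[symmetric] by (simp only: cheb.simps(3) diff_add_cancel)
  qed
  also have "\<dots> - (\<Sum>k\<le>n. cheb (m + n - 2 * k)) =
      (\<Sum>k\<le>Suc n. cheb (m + Suc (Suc n) - 2 * k)) + cheb (m + n - 2 * Suc n)"
    by (simp add: sum.distrib)
  also have "\<dots> = (\<Sum>k\<le>Suc (Suc n). cheb (m + Suc (Suc n) - 2 * k))"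
    by simp
  finally show ?case .
qed

text \<open>
  The span of the \<open>U\<^sub>l\<close> is closed under multiplication by \<open>t\<close> and contains \<open>1\<close>.
\<close>

lemma cheb_spans_polynomials:
  fixes J :: "real poly \<Rightarrow> real"
  assumes add: "\<And>p q. J (p + q) = J p + J q" and smult: "\<And>c p. J (smult c p) = c * J p"
    and zero: "\<And>l. J (cheb l) = 0"
  shows "J p = 0"
proof -
  have "J (monom 1 k * cheb l) = 0" for k l
  proof (induction k arbitrary: l)
    case 0
    show ?case by (simp add: zero)
  next
    case (Suc k)
    have X: "monom 1 (Suc k) = [:0, 1:] * (monom 1 k :: real poly)"
      by (simp add: monom_Suc)
    show ?case
    proof (cases l)
      case 0
      have "monom 1 (Suc k) * cheb l = smult (1/2) (monom 1 k * cheb (Suc 0))"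
        by (simp add: 0 monom_Suc numeral_poly)
      then show ?thesis by (simp only: smult Suc.IH mult_zero_right)
    next
      case (Suc j)
      have "monom 1 (Suc k) * cheb l = smult (1/2) (monom 1 k * cheb (Suc l) + monom 1 k * cheb j)"
        by (simp add: Suc monom_Suc numeral_poly algebra_simps)
      then show ?thesis by (simp only: smult add Suc.IH) simp
    qed
  qed
  from this[of _ 0] have mon: "J (monom 1 k) = 0" for k by simp
  have "J 0 = 0" using smult[of 0 0] by simp
  then have sum: "J (\<Sum>i\<in>A. h i) = (\<Sum>i\<in>A. J (h i))" for A :: "nat set" and h
    by (induction A rule: infinite_finite_induct) (auto simp: add)
  have "J p = J (\<Sum>i\<le>degree p. smult (coeff p i) (monom 1 i))"
    by (simp only: smult_monom mult_1_right poly_as_sum_of_monoms)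
  also have "\<dots> = 0"
    unfolding sum by (intro sum.neutral ballI) (simp only: smult mon mult_zero_right)
  finally show ?thesis .
qed

section \<open>Derivatives along the quaternionic rotations\<close>

text \<open>
  Left multiplication by the quaternion units \<open>i\<close>, \<open>j\<close>, \<open>k\<close> in the coordinates
  \<open>p\<^sub>1 + p\<^sub>2 i + p\<^sub>3 j + p\<^sub>4 k\<close>.  At a point \<open>p\<close> of the sphere, the three images of \<open>p\<close> form an orthonormal basis
  of the tangent space; this is what \<open>sum_quat_coordinates\<close> and \<open>sum_inner_quat_squared\<close> say.
\<close>

definition quat :: "3 \<Rightarrow> real ^ 4 \<Rightarrow> real ^ 4" where
  "quat a p =
    (if a = 1 then vector [- p $ 2, p $ 1, - p $ 4, p $ 3]
     else if a = 2 then vector [- p $ 3, p $ 4, p $ 1, - p $ 2]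
     else vector [- p $ 4, - p $ 3, p $ 2, p $ 1])"

lemma vector_4_nth [simp]:
  "(vector [w, x, y, z] :: 'a::zero ^ 4) $ 1 = w" "(vector [w, x, y, z] :: 'a ^ 4) $ 2 = x"
  "(vector [w, x, y, z] :: 'a ^ 4) $ 3 = y" "(vector [w, x, y, z] :: 'a ^ 4) $ 4 = z"
  unfolding vector_def by simp_all

lemma linear_quat: "linear (quat a)"
  by (rule linearI) (simp_all add: quat_def vec_eq_iff forall_4)

lemma quat_quat [simp]: "quat a (quat a p) = - p"
  by (simp add: quat_def vec_eq_iff forall_4)

lemma inner_quat_quat [simp]: "quat a p \<bullet> quat a q = p \<bullet> q"
  by (simp add: quat_def inner_vec_def sum_4)

lemma inner_quat_self [simp]: "p \<bullet> quat a p = 0"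
  by (simp add: quat_def inner_vec_def sum_4)

lemma norm_quat [simp]: "norm (quat a p) = norm p"
  by (simp add: norm_eq_sqrt_inner)

lemma continuous_on_quat [continuous_intros]:
  "continuous_on A f \<Longrightarrow> continuous_on A (\<lambda>x. quat a (f x))"
  using linear_continuous_on[OF linear_quat[unfolded linear_conv_bounded_linear]]
  by (rule continuous_on_compose2) auto

lemma sum_quat_coordinates:
  "(\<Sum>a\<in>UNIV. quat a p $ i * quat a p $ j) = (if i = j then p \<bullet> p else 0) - p $ i * p $ j"
proof -
  have "\<forall>i j. (\<Sum>a\<in>UNIV. quat a p $ i * quat a p $ j) = (if i = j then p \<bullet> p else 0) - p $ i * p $ j"
    unfolding forall_4 by (simp add: sum_3 inner_vec_def sum_4 quat_def)
  then show ?thesis by blast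
qed

lemma sum_inner_quat_squared: "(\<Sum>a\<in>UNIV. (x \<bullet> quat a p)\<^sup>2) = (x \<bullet> x) * (p \<bullet> p) - (x \<bullet> p)\<^sup>2"
  by (simp add: sum_3 inner_vec_def sum_4 quat_def power2_eq_square algebra_simps)

definition rot :: "3 \<Rightarrow> real \<Rightarrow> real ^ 4 \<Rightarrow> real ^ 4" where
  "rot a t p = cos t *\<^sub>R p + sin t *\<^sub>R quat a p"

lemma rot_0 [simp]: "rot a 0 p = p"
  by (simp add: rot_def)

lemma rot_add: "rot a s (rot a t p) = rot a (s + t) p"
  by (simp add: rot_def linear_add[OF linear_quat] linear_cmul[OF linear_quat]
      scaleR_add_left scaleR_add_right cos_add sin_add scaleR_diff_left scaleR_diff_right)

lemma orthogonal_transformation_rot: "orthogonal_transformation (rot a t)"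
  unfolding orthogonal_transformation
proof
  have "linear (\<lambda>p. cos t *\<^sub>R p + sin t *\<^sub>R quat a p)"
    by (intro linear_compose_add linear_compose_scale_right linear_quat linear_id[unfolded id_def])
  then show "linear (rot a t)"
    by (simp add: rot_def[abs_def])
  show "\<forall>v. norm (rot a t v) = norm v"
  proof
    fix v
    have "rot a t v \<bullet> rot a t v = ((cos t)\<^sup>2 + (sin t)\<^sup>2) * (v \<bullet> v)"
      unfolding rot_def
      by (simp only: inner_add_left inner_add_right inner_scaleR_left inner_scaleR_right inner_quat_quat
          inner_quat_self inner_commute[of "quat a v" v] power2_eq_square) (simp only: ring_distribs mult_ac mult_zero_right add_0_left add_0_right)
    then show "norm (rot a t v) = norm v"
      by (simp only: sin_cos_squared_add2 mult_1_left norm_eq_sqrt_inner)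
  qed
qed

lemma norm_rot [simp]: "norm (rot a t p) = norm p"
  by (rule orthogonal_transformation_norm[OF orthogonal_transformation_rot])

lemma continuous_on_rot: "continuous_on A (rot a t)"
  unfolding rot_def[abs_def] by (intro continuous_intros)

text \<open>
  \<open>v\<close> is the derivative of \<open>u\<close> along the orbits of the rotation group with index \<open>a\<close>.  Only the time \<open>0\<close> is
  mentioned because the group law moves the derivative to all other times (\<open>rot_deriv_along\<close>).
\<close>

definition rot_deriv :: "3 \<Rightarrow> (real ^ 4 \<Rightarrow> real) \<Rightarrow> (real ^ 4 \<Rightarrow> real) \<Rightarrow> bool" where
  "rot_deriv a u v \<longleftrightarrow> continuous_on S3 u \<and> continuous_on S3 v \<and>
     (\<forall>p\<in>S3. ((\<lambda>t. u (rot a t p)) has_real_derivative v p) (at 0))"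

lemma rot_deriv_along:
  assumes "rot_deriv a u v" "p \<in> S3"
  shows "((\<lambda>t. u (rot a t p)) has_real_derivative v (rot a t p)) (at t)"
proof -
  have "((\<lambda>s. u (rot a s (rot a t p))) has_real_derivative v (rot a t p)) (at 0)"
    using assms by (simp add: rot_deriv_def)
  then show ?thesis
    by (simp add: rot_add DERIV_shift[of _ _ 0 t, simplified] add.commute)
qed

lemma rot_deriv_mult:
  assumes "rot_deriv a u u'" "rot_deriv a w w'"
  shows "rot_deriv a (\<lambda>p. u p * w p) (\<lambda>p. u' p * w p + u p * w' p)"
  using assms unfolding rot_deriv_def
  by (auto intro!: continuous_intros derivative_eq_intros)

lemma rot_deriv_add:
  assumes "rot_deriv a u u'" "rot_deriv a w w'"
  shows "rot_deriv a (\<lambda>p. u p + w p) (\<lambda>p. u' p + w' p)"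
  using assms unfolding rot_deriv_def
  by (auto intro!: continuous_intros derivative_eq_intros)

lemma rot_deriv_inner: "rot_deriv a (\<lambda>p. x \<bullet> p) (\<lambda>p. x \<bullet> quat a p)"
  unfolding rot_deriv_def rot_def
  by (auto intro!: continuous_intros derivative_eq_intros simp: inner_add_right)

lemma rot_deriv_inner_quat: "rot_deriv a (\<lambda>p. x \<bullet> quat a p) (\<lambda>p. - (x \<bullet> p))"
  unfolding rot_deriv_def rot_def
  by (auto intro!: continuous_intros derivative_eq_intros
     simp: inner_add_right inner_diff_right linear_add[OF linear_quat] linear_cmul[OF linear_quat])

lemma rot_deriv_poly:
  "rot_deriv a (\<lambda>p. poly q (x \<bullet> p)) (\<lambda>p. poly (pderiv q) (x \<bullet> p) * (x \<bullet> quat a p))"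
  unfolding rot_deriv_def
proof (intro conjI ballI)
  fix p assume "p \<in> S3"
  then have "((\<lambda>t. x \<bullet> rot a t p) has_real_derivative x \<bullet> quat a p) (at 0)"
    using rot_deriv_inner[of a x] unfolding rot_deriv_def by blast
  from DERIV_chain2[OF poly_DERIV this]
  show "((\<lambda>t. poly q (x \<bullet> rot a t p)) has_real_derivative poly (pderiv q) (x \<bullet> p) * (x \<bullet> quat a p)) (at 0)"
    by simp
qed (intro continuous_intros)+

text \<open>
  The integral of \<open>u\<close> over the sphere does not change when \<open>u\<close> is rotated, so its difference quotients
  have integral zero; they converge boundedly to \<open>v\<close> by the mean value theorem.
\<close>

lemma integral_rot_deriv:
  assumes D: "rot_deriv a u v"
  shows "(LINT p|round_prob. v p) = 0"
proof -
  have cu: "continuous_on S3 u" and cv: "continuous_on S3 v"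
    using D by (auto simp: rot_deriv_def)
  note iu = integrable_round_prob[OF cu]
  define h where "h k = 1 / real (Suc k)" for k
  have h: "h k > 0" for k by (simp add: h_def)
  have h0: "h \<longlonglongrightarrow> 0"
    unfolding h_def by (rule LIMSEQ_Suc[OF lim_1_over_n])
  define q where "q k p = (u (rot a (h k) p) - u p) / h k" for k p
  obtain B where B: "\<forall>y\<in>v ` S3. norm y \<le> B"
    using compact_imp_bounded[OF compact_continuous_image[OF cv compact_sphere]]
    unfolding bounded_iff by blast
  have crot: "continuous_on S3 (\<lambda>p. u (rot a t p))" for t
    by (rule continuous_on_compose2[OF cu]) (auto intro: continuous_on_rot)
  have cq: "continuous_on S3 (q k)" for k
    unfolding q_def using h[of k] by (intro continuous_intros crot cu) auto
  have "(\<lambda>k. LINT p|round_prob. q k p) \<longlonglongrightarrow> (LINT p|round_prob. v p)"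
  proof (rule integral_dominated_convergence[where w = "\<lambda>_. B"])
    have "(\<lambda>k. q k p) \<longlonglongrightarrow> v p" if p: "p \<in> S3" for p
    proof -
      have "((\<lambda>t. (u (rot a t p) - u p) / t) \<longlongrightarrow> v p) (at 0)"
        using rot_deriv_along[OF D p, of 0] by (simp add: has_field_derivative_iff)
      then show ?thesis
        unfolding q_def
        by (rule filterlim_compose) (use h0 h in \<open>auto simp: filterlim_at less_imp_neq[symmetric] intro!: always_eventually\<close>)
    qed
    then show "AE p in round_prob. (\<lambda>k. q k p) \<longlonglongrightarrow> v p" by (intro AE_I2) simp
    have "norm (q k p) \<le> B" if p: "p \<in> S3" for k p
    proof -
      obtain z where "u (rot a (h k) p) - u (rot a 0 p) = (h k - 0) * v (rot a z p)"
        using MVT2[of 0 "h k" "\<lambda>t. u (rot a t p)" "\<lambda>t. v (rot a t p)"] h[of k] rot_deriv_along[OF D p]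
        by auto
      then have "q k p = v (rot a z p)"
        using h[of k] by (simp add: q_def)
      then show ?thesis using B p by auto
    qed
    then show "AE p in round_prob. norm (q k p) \<le> B" for k by (intro AE_I2) simp
  qed (use integrable_round_prob[OF cq] integrable_round_prob[OF cv] in auto)
  moreover have "(LINT p|round_prob. q k p) = 0" for k
    unfolding q_def using iu integrable_round_prob[OF crot]
      integral_orthogonal[OF orthogonal_transformation_rot borel_measurable_integrable[OF iu]]
    by simp
  ultimately show ?thesis
    by (simp add: LIMSEQ_const_iff)
qed

lemma rot_deriv_by_parts:
  assumes "rot_deriv a u u'" "rot_deriv a w w'"
  shows "(LINT p|round_prob. u' p * w p) = - (LINT p|round_prob. u p * w' p)"
proof -
  have "(LINT p|round_prob. u' p * w p + u p * w' p) = 0"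
    by (rule integral_rot_deriv[OF rot_deriv_mult[OF assms]])
  moreover have "integrable round_prob (\<lambda>p. u' p * w p)" "integrable round_prob (\<lambda>p. u p * w' p)"
    using assms by (auto simp: rot_deriv_def intro!: integrable_round_prob continuous_intros)
  ultimately show ?thesis by simp
qed

text \<open>
  Since the frame \<open>quat a p\<close> is orthonormal and the curves \<open>t \<mapsto> rot a t p\<close> are geodesics, the sum of the second
  derivatives along the three rotation groups is the Laplace-Beltrami operator.
\<close>

definition has_laplacian :: "(real ^ 4 \<Rightarrow> real) \<Rightarrow> (real ^ 4 \<Rightarrow> real) \<Rightarrow> bool" where
  "has_laplacian u w \<longleftrightarrow> (\<exists>u1 u2. (\<forall>a. rot_deriv a u (u1 a) \<and> rot_deriv a (u1 a) (u2 a)) \<and>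
     (\<forall>p\<in>S3. w p = (\<Sum>a\<in>UNIV. u2 a p)))"

lemma has_laplacian_continuous:
  assumes "has_laplacian u v"
  shows "continuous_on S3 u" "continuous_on S3 v"
proof -
  obtain u1 u2 where u: "\<And>a. rot_deriv a u (u1 a)" "\<And>a. rot_deriv a (u1 a) (u2 a)"
    "\<And>p. p \<in> S3 \<Longrightarrow> v p = (\<Sum>a\<in>UNIV. u2 a p)"
    using assms unfolding has_laplacian_def by blast
  show "continuous_on S3 u" using u(1) by (auto simp: rot_deriv_def)
  have "continuous_on S3 (\<lambda>p. \<Sum>a\<in>UNIV. u2 a p)"
    using u(2) by (auto simp: rot_deriv_def intro!: continuous_intros)
  then show "continuous_on S3 v"
    using u(3) by (subst continuous_on_cong[OF refl, where g = "\<lambda>p. \<Sum>a\<in>UNIV. u2 a p"]) auto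
qed

text \<open>
  Both sides are \<open>- \<integral> \<nabla>u \<bullet> \<nabla>w\<close>, the right-hand side written in the orthonormal frame.
\<close>

lemma Dirichlet_form:
  assumes u: "\<And>a. rot_deriv a u (u1 a)" "\<And>a. rot_deriv a (u1 a) (u2 a)"
    and w: "\<And>a. rot_deriv a w (w1 a)"
  shows "(LINT p|round_prob. (\<Sum>a\<in>UNIV. u2 a p) * w p) = - (\<Sum>a\<in>UNIV. LINT p|round_prob. u1 a p * w1 a p)"
proof -
  have "integrable round_prob (\<lambda>p. u2 a p * w p)" for a
    using u(2)[of a] w[of a] by (auto simp: rot_deriv_def intro!: integrable_round_prob continuous_intros)
  then have "(LINT p|round_prob. (\<Sum>a\<in>UNIV. u2 a p) * w p) = (\<Sum>a\<in>UNIV. LINT p|round_prob. u2 a p * w p)"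
    by (simp add: sum_distrib_right)
  also have "\<dots> = (\<Sum>a\<in>UNIV. - (LINT p|round_prob. u1 a p * w1 a p))"
    by (intro sum.cong refl rot_deriv_by_parts[OF u(2) w])
  finally show ?thesis by (simp add: sum_negf)
qed

lemma Green:
  assumes "has_laplacian u v" "has_laplacian w z"
  shows "(LINT p|round_prob. v p * w p) = (LINT p|round_prob. u p * z p)"
proof -
  obtain u1 u2 where u: "\<And>a. rot_deriv a u (u1 a)" "\<And>a. rot_deriv a (u1 a) (u2 a)"
    "\<And>p. p \<in> S3 \<Longrightarrow> v p = (\<Sum>a\<in>UNIV. u2 a p)"
    using assms unfolding has_laplacian_def by blast
  obtain w1 w2 where w: "\<And>a. rot_deriv a w (w1 a)" "\<And>a. rot_deriv a (w1 a) (w2 a)"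
    "\<And>p. p \<in> S3 \<Longrightarrow> z p = (\<Sum>a\<in>UNIV. w2 a p)"
    using assms unfolding has_laplacian_def by blast
  have "(LINT p|round_prob. v p * w p) = (LINT p|round_prob. (\<Sum>a\<in>UNIV. u2 a p) * w p)"
    by (rule integral_round_prob_cong) (simp add: u)
  also have "\<dots> = (LINT p|round_prob. (\<Sum>a\<in>UNIV. w2 a p) * u p)"
    unfolding Dirichlet_form[OF u(1,2) w(1)] Dirichlet_form[OF w(1,2) u(1)] by (simp add: mult.commute)
  also have "\<dots> = (LINT p|round_prob. u p * z p)"
    by (rule integral_round_prob_cong) (simp add: w)
  finally show ?thesis .
qed

lemma has_laplacian_zonal_cheb:
  assumes x: "x \<in> S3"
  shows "has_laplacian (\<lambda>p. poly (cheb l) (x \<bullet> p)) (\<lambda>p. - (real l * (real l + 2)) * poly (cheb l) (x \<bullet> p))"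
  unfolding has_laplacian_def
proof (intro exI conjI allI ballI)
  let ?q = "cheb l"
  fix a
  show "rot_deriv a (\<lambda>p. poly ?q (x \<bullet> p)) (\<lambda>p. poly (pderiv ?q) (x \<bullet> p) * (x \<bullet> quat a p))"
    by (rule rot_deriv_poly)
  show "rot_deriv a (\<lambda>p. poly (pderiv ?q) (x \<bullet> p) * (x \<bullet> quat a p))
     (\<lambda>p. poly (pderiv (pderiv ?q)) (x \<bullet> p) * (x \<bullet> quat a p) * (x \<bullet> quat a p) +
       poly (pderiv ?q) (x \<bullet> p) * (- (x \<bullet> p)))"
    by (intro rot_deriv_mult rot_deriv_poly rot_deriv_inner_quat)
next
  let ?q = "cheb l"
  fix p assume p: "p \<in> S3"
  let ?t = "x \<bullet> p"
  have "(\<Sum>a\<in>UNIV. poly (pderiv (pderiv ?q)) ?t * (x \<bullet> quat a p) * (x \<bullet> quat a p) +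
       poly (pderiv ?q) ?t * (- ?t)) =
     poly (pderiv (pderiv ?q)) ?t * (\<Sum>a\<in>UNIV. (x \<bullet> quat a p)\<^sup>2) - 3 * ?t * poly (pderiv ?q) ?t"
    by (simp add: sum.distrib sum_subtractf sum_distrib_left power2_eq_square mult_ac)
  also have "\<dots> = (1 - ?t\<^sup>2) * poly (pderiv (pderiv ?q)) ?t - 3 * ?t * poly (pderiv ?q) ?t"
    using x p unfolding sum_inner_quat_squared by (simp add: norm_eq_1)
  also have "\<dots> = - (real l * (real l + 2)) * poly ?q ?t"
    by (rule cheb_ode)
  finally show "- (real l * (real l + 2)) * poly ?q ?t =
     (\<Sum>a\<in>UNIV. poly (pderiv (pderiv ?q)) ?t * (x \<bullet> quat a p) * (x \<bullet> quat a p) +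
       poly (pderiv ?q) ?t * (- ?t))" by simp
qed

section \<open>Zonal kernels reproduce eigenfunctions\<close>

text \<open>
  The cone over a cap contains a nonempty open set.
\<close>

lemma emeasure_cap_pos:
  assumes x: "x \<in> S3" and c: "0 \<le> c" "c < 1"
  shows "{p \<in> S3. c < x \<bullet> p} \<in> sets round_prob" "emeasure round_prob {p \<in> S3. c < x \<bullet> p} \<noteq> 0"
proof -
  let ?A = "{p \<in> S3. c < x \<bullet> p}"
  have "open {p. c < x \<bullet> p}"
    by (intro open_Collect_less continuous_intros)
  then have "S3 \<inter> {p. c < x \<bullet> p} \<in> sets borel"
    by (intro sets.Int) (auto intro: borel_closed)
  also have "S3 \<inter> {p. c < x \<bullet> p} = ?A" by auto
  finally show A: "?A \<in> sets round_prob" by (auto simp: sets_round_prob_iff)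
  show "emeasure round_prob ?A \<noteq> 0"
  proof
    assume "emeasure round_prob ?A = 0"
    then have null: "emeasure lborel {t *\<^sub>R x | t x. 0 < t \<and> t \<le> 1 \<and> x \<in> ?A} = 0" (is "emeasure lborel ?C = 0")
      unfolding emeasure_round_prob[OF A] by (auto simp: ennreal_eq_0_iff)
    let ?U = "{y. norm y < 1 \<and> c * norm y < x \<bullet> y}"
    have U: "open ?U"
      by (intro open_Collect_conj open_Collect_less continuous_intros)
    have "?U \<subseteq> ?C"
    proof
      fix y assume y: "y \<in> ?U"
      then have "y \<noteq> 0" by auto
      then have "y = norm y *\<^sub>R (y /\<^sub>R norm y)" "0 < norm y" "norm y \<le> 1" "y /\<^sub>R norm y \<in> ?A"
        using y by (auto simp: field_simps)
      then show "y \<in> ?C" by blast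
    qed
    moreover have "?C \<in> sets lborel"
      using cone_borel[OF A] by simp
    ultimately have "?U \<in> null_sets lborel"
      using null U by (metis (no_types, lifting) null_sets_subset null_setsI borel_open sets_lborel)
    then have "negligible ?U"
      using negligible_iff_null_sets null_sets_completionI by blast
    moreover have "(1/2) *\<^sub>R x \<in> ?U"
    proof -
      have "norm x = 1" "x \<bullet> x = 1" using x by (simp_all add: norm_eq_1)
      then show ?thesis using c by simp
    qed
    ultimately show False
      using open_not_negligible[OF U] by blast
  qed
qed

definition eigenfn :: "nat \<Rightarrow> (real ^ 4 \<Rightarrow> real) \<Rightarrow> bool" where
  "eigenfn m u \<longleftrightarrow> has_laplacian u (\<lambda>p. - (real m * (real m + 2)) * u p)"

lemma eigenfn_zonal: "x \<in> S3 \<Longrightarrow> eigenfn l (\<lambda>p. poly (cheb l) (x \<bullet> p))"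
  unfolding eigenfn_def by (rule has_laplacian_zonal_cheb)

lemma eigenfn_continuous: "eigenfn m u \<Longrightarrow> continuous_on S3 u"
  unfolding eigenfn_def by (rule has_laplacian_continuous)

text \<open>
  Green's identity moves the Laplacian from one factor to the other, and the eigenvalues differ.
\<close>

lemma eigenfn_orthogonal_zonal:
  assumes f: "eigenfn m f" and x: "x \<in> S3" and lm: "l \<noteq> m"
  shows "(LINT p|round_prob. poly (cheb l) (x \<bullet> p) * f p) = 0"
proof -
  let ?I = "LINT p|round_prob. poly (cheb l) (x \<bullet> p) * f p"
  have "(LINT p|round_prob. - (real m * (real m + 2)) * f p * poly (cheb l) (x \<bullet> p)) =
      (LINT p|round_prob. f p * (- (real l * (real l + 2)) * poly (cheb l) (x \<bullet> p)))"
    by (rule Green[OF f[unfolded eigenfn_def] has_laplacian_zonal_cheb[OF x]])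
  moreover have "(LINT p|round_prob. - (real m * (real m + 2)) * f p * poly (cheb l) (x \<bullet> p)) =
      - (real m * (real m + 2)) * ?I"
    by (subst integral_mult_right_zero[symmetric]) (simp add: mult_ac)
  moreover have "(LINT p|round_prob. f p * (- (real l * (real l + 2)) * poly (cheb l) (x \<bullet> p))) =
      - (real l * (real l + 2)) * ?I"
    by (subst integral_mult_right_zero[symmetric]) (simp add: mult_ac)
  ultimately have "(real m - real l) * (real m + real l + 2) * ?I = 0"
    by (simp add: algebra_simps)
  then show ?thesis using lm by (simp add: of_nat_eq_iff)
qed

text \<open>
  By the Weierstrass theorem, \<open>r\<close> is orthogonal to every continuous function of \<open>x \<bullet> p\<close>, in particular
  to a bump function around \<open>p = x\<close> supported where \<open>r\<close> has the sign of \<open>r x\<close>.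
\<close>

lemma zero_if_orthogonal_to_zonal:
  assumes r: "continuous_on S3 r" and x: "x \<in> S3"
    and orth: "\<And>l. (LINT p|round_prob. poly (cheb l) (x \<bullet> p) * r p) = 0"
  shows "r x = 0"
proof (rule ccontr)
  assume rx: "r x \<noteq> 0"
  have integ: "integrable round_prob (\<lambda>p. h (x \<bullet> p) * r p)" if h: "continuous_on {-1..1} h" for h :: "real \<Rightarrow> real"
  proof (intro integrable_round_prob continuous_on_mult r continuous_on_compose2[OF h] continuous_intros)
    show "(\<lambda>p. x \<bullet> p) ` S3 \<subseteq> {-1..1}"
    proof
      fix t assume "t \<in> (\<lambda>p. x \<bullet> p) ` S3"
      then obtain p where "t = x \<bullet> p" "p \<in> S3" by blast
      then show "t \<in> {-1..1}"
        using x Cauchy_Schwarz_ineq2[of x p] by (simp add: abs_le_iff)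
    qed
  qed
  have poly0: "(LINT p|round_prob. poly q (x \<bullet> p) * r p) = 0" for q
  proof (rule cheb_spans_polynomials[of "\<lambda>q. LINT p|round_prob. poly q (x \<bullet> p) * r p"])
    have i: "integrable round_prob (\<lambda>p. poly q (x \<bullet> p) * r p)" for q
      by (intro integ continuous_intros)
    show "(LINT p|round_prob. poly (q + s) (x \<bullet> p) * r p) =
        (LINT p|round_prob. poly q (x \<bullet> p) * r p) + (LINT p|round_prob. poly s (x \<bullet> p) * r p)" for q s
      using i[of q] i[of s] by (simp add: distrib_right)
    show "(LINT p|round_prob. poly (smult c q) (x \<bullet> p) * r p) = c * (LINT p|round_prob. poly q (x \<bullet> p) * r p)" for c q
      by (simp add: mult.assoc)
  qed (rule orth)
  have cont0: "(LINT p|round_prob. h (x \<bullet> p) * r p) = 0" if h: "continuous_on {-1..1} h" for h :: "real \<Rightarrow> real"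
  proof -
    let ?N = "LINT p|round_prob. \<bar>r p\<bar>"
    have ir: "integrable round_prob (\<lambda>p. \<bar>r p\<bar>)" by (intro integrable_round_prob continuous_intros r)
    have le: "\<bar>LINT p|round_prob. h (x \<bullet> p) * r p\<bar> \<le> e * ?N" if e: "e > 0" for e
    proof -
      obtain g where g: "real_polynomial_function g" "\<And>t. t \<in> {-1..1} \<Longrightarrow> \<bar>h t - g t\<bar> < e"
        using Stone_Weierstrass_real_polynomial_function[OF compact_Icc h e] by blast
      obtain a n where gs: "g = (\<lambda>t. \<Sum>i\<le>n. a i * t ^ i)"
        using g(1) unfolding real_polynomial_function_iff_sum by blast
      define q where "q = (\<Sum>i\<le>n. monom (a i) i)"
      have gq: "g t = poly q t" for t
        by (simp add: gs q_def poly_sum poly_monom)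
      have "(LINT p|round_prob. h (x \<bullet> p) * r p) = (LINT p|round_prob. h (x \<bullet> p) * r p) - (LINT p|round_prob. poly q (x \<bullet> p) * r p)"
        by (simp add: poly0)
      also have "\<dots> = (LINT p|round_prob. h (x \<bullet> p) * r p - poly q (x \<bullet> p) * r p)"
        by (intro Bochner_Integration.integral_diff[symmetric] integ h continuous_intros)
      also have "\<bar>\<dots>\<bar> \<le> (LINT p|round_prob. e * \<bar>r p\<bar>)"
      proof (rule integral_abs_bound_integral)
        fix p assume "p \<in> space round_prob"
        then have "x \<bullet> p \<in> {-1..1}"
          using x Cauchy_Schwarz_ineq2[of x p] by (simp add: abs_le_iff)
        from g(2)[OF this] show "\<bar>h (x \<bullet> p) * r p - poly q (x \<bullet> p) * r p\<bar> \<le> e * \<bar>r p\<bar>"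
          by (simp add: gq abs_mult mult_right_mono flip: left_diff_distrib)
      qed (intro Bochner_Integration.integrable_diff integ h integrable_mult_right ir continuous_intros)+
      finally show ?thesis by simp
    qed
    have N0: "?N \<ge> 0" by simp
    have scale: "e / (N + 1) * N \<le> e \<and> e / (N + 1) > 0" if "0 \<le> N" "0 < e" for e N :: real
      using that by (simp add: field_simps)
    have "\<bar>LINT p|round_prob. h (x \<bullet> p) * r p\<bar> \<le> 0"
    proof (rule field_le_epsilon)
      fix e :: real assume "e > 0"
      then have "e / (?N + 1) * ?N \<le> e" "e / (?N + 1) > 0"
        using scale[OF N0] by blast+
      then show "\<bar>LINT p|round_prob. h (x \<bullet> p) * r p\<bar> \<le> 0 + e"
        using le[of "e / (?N + 1)"] by linarith
    qed
    then show ?thesis by simp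
  qed
  obtain d where d: "d > 0" "\<And>p. p \<in> S3 \<Longrightarrow> dist p x < d \<Longrightarrow> dist (r p) (r x) < \<bar>r x\<bar>"
    using r x rx unfolding continuous_on_iff by (metis zero_less_abs_iff)
  \<comment> \<open>On the unit sphere, \<open>(dist p x)\<^sup>2 = 2 - 2 (x \<bullet> p)\<close>, so \<open>x \<bullet> p > c\<close> places \<open>p\<close> within distance \<open>d\<close> of \<open>x\<close>.\<close>
  define c where "c = max 0 (1 - d\<^sup>2 / 2)"
  have c: "0 \<le> c" "c < 1" using d(1) by (auto simp: c_def)
  have near: "r p * r x > 0" if p: "p \<in> S3" "c < x \<bullet> p" for p
  proof -
    have "(dist p x)\<^sup>2 = 2 - 2 * (x \<bullet> p)"
      using p x by (simp add: dist_norm power2_norm_eq_inner inner_diff_left inner_diff_right inner_commute norm_eq_1)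
    then have "(dist p x)\<^sup>2 < d\<^sup>2" using p(2) by (simp add: c_def)
    then have "dist p x < d" using d(1) by (simp add: power_less_imp_less_base)
    then have "\<bar>r p - r x\<bar> < \<bar>r x\<bar>" using d(2)[OF p(1)] by (simp add: dist_real_def)
    then show ?thesis by (auto simp: zero_less_mult_iff abs_if split: if_splits)
  qed
  define h where "h t = max 0 (t - c)" for t
  have hc: "continuous_on {-1..1} h" unfolding h_def by (intro continuous_intros)
  have "(LINT p|round_prob. h (x \<bullet> p) * r p * r x) = 0"
    using cont0[OF hc] by simp
  moreover have "AE p in round_prob. 0 \<le> h (x \<bullet> p) * r p * r x"
  proof (rule AE_I2)
    fix p assume "p \<in> space round_prob"
    then show "0 \<le> h (x \<bullet> p) * r p * r x"
      using near[of p] by (cases "c < x \<bullet> p") (auto simp: h_def mult.assoc)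
  qed
  moreover have "integrable round_prob (\<lambda>p. h (x \<bullet> p) * r p * r x)"
    using integ[OF hc] by simp
  ultimately have "AE p in round_prob. h (x \<bullet> p) * r p * r x = 0"
    using integral_nonneg_eq_0_iff_AE by blast
  then have "AE p in round_prob. \<not> c < x \<bullet> p"
    by (rule AE_mp) (use near in \<open>fastforce intro!: AE_I2 simp: h_def\<close>)
  then have "emeasure round_prob {p \<in> space round_prob. \<not> \<not> c < x \<bullet> p} = 0"
    using emeasure_cap_pos(1)[OF x c] by (intro AE_iff_measurable[THEN iffD1]) auto
  then show False
    using emeasure_cap_pos(2)[OF x c] by simp
qed

text \<open>
  The factor \<open>l + 1\<close> makes the kernel reproduce eigenfunctions of degree \<open>l\<close>.
\<close>

definition zonal_kernel :: "nat \<Rightarrow> real ^ 4 \<Rightarrow> real ^ 4 \<Rightarrow> real" where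
  "zonal_kernel l x y = (real l + 1) * poly (cheb l) (x \<bullet> y)"

definition harmonic_proj :: "nat \<Rightarrow> (real ^ 4 \<Rightarrow> real) \<Rightarrow> real ^ 4 \<Rightarrow> real" where
  "harmonic_proj l u x = (LINT y|round_prob. zonal_kernel l x y * u y)"

lemma zonal_kernel_commute: "zonal_kernel l x y = zonal_kernel l y x"
  by (simp add: zonal_kernel_def inner_commute)

lemma continuous_on_zonal_kernel [continuous_intros]:
  "continuous_on A f \<Longrightarrow> continuous_on A g \<Longrightarrow> continuous_on A (\<lambda>z. zonal_kernel l (f z) (g z))"
  unfolding zonal_kernel_def by (intro continuous_intros)

lemma integral_zonal:
  assumes "x \<in> S3"
  shows "(LINT p|round_prob. poly (cheb l) (x \<bullet> p)) = (if l = 0 then 1 else 0)"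
  using eigenfn_orthogonal_zonal[OF eigenfn_zonal[OF assms, of 0] assms, of l] by simp

text \<open>
  The square of a character contains the trivial character exactly once.
\<close>

lemma integral_zonal_squared:
  assumes x: "x \<in> S3"
  shows "(LINT p|round_prob. (poly (cheb m) (x \<bullet> p))\<^sup>2) = 1"
proof -
  have "(poly (cheb m) t)\<^sup>2 = (\<Sum>k\<le>m. poly (cheb (2 * m - 2 * k)) t)" for t
    using arg_cong[OF cheb_mult[of m m], of "\<lambda>q. poly q t"] by (simp add: power2_eq_square poly_sum mult_2)
  then have "(LINT p|round_prob. (poly (cheb m) (x \<bullet> p))\<^sup>2) =
      (\<Sum>k\<le>m. LINT p|round_prob. poly (cheb (2 * m - 2 * k)) (x \<bullet> p))"
    by (simp add: integrable_round_prob continuous_intros)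
  also have "\<dots> = (\<Sum>k\<le>m. if k = m then 1 else 0)"
    unfolding integral_zonal[OF x] by (intro sum.cong refl) auto
  finally show ?thesis by simp
qed

text \<open>
  Subtract from \<open>f\<close> its component \<open>c\<close> along the zonal function of degree \<open>m\<close> with pole \<open>x\<close>.  The
  remainder is orthogonal to all zonal functions with pole \<open>x\<close>, hence vanishes at \<open>x\<close>, and the zonal function
  takes the value \<open>m + 1\<close> there.
\<close>

lemma eigenfn_reproducing:
  assumes f: "eigenfn m f" and x: "x \<in> S3"
  shows "harmonic_proj m f x = f x"
proof -
  note cf = eigenfn_continuous[OF f]
  define c where "c = (LINT p|round_prob. poly (cheb m) (x \<bullet> p) * f p)"
  define r where "r p = f p - c * poly (cheb m) (x \<bullet> p)" for p
  have "r x = 0"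
  proof (rule zero_if_orthogonal_to_zonal[OF _ x])
    show "continuous_on S3 r" unfolding r_def by (intro continuous_intros cf)
    fix l
    have "(LINT p|round_prob. poly (cheb l) (x \<bullet> p) * r p) =
        (LINT p|round_prob. poly (cheb l) (x \<bullet> p) * f p - c * (poly (cheb l) (x \<bullet> p) * poly (cheb m) (x \<bullet> p)))"
      by (simp add: r_def algebra_simps)
    also have "\<dots> = (LINT p|round_prob. poly (cheb l) (x \<bullet> p) * f p) -
        c * (LINT p|round_prob. poly (cheb l) (x \<bullet> p) * poly (cheb m) (x \<bullet> p))"
      by (subst Bochner_Integration.integral_diff) (auto intro!: integrable_round_prob continuous_intros cf)
    also have "\<dots> = 0"
    proof (cases "l = m")
      case True
      then show ?thesis
        using integral_zonal_squared[OF x, of m] by (simp add: c_def power2_eq_square)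
    next
      case False
      then show ?thesis
        using eigenfn_orthogonal_zonal[OF f x False] eigenfn_orthogonal_zonal[OF eigenfn_zonal[OF x] x False]
        by simp
    qed
    finally show "(LINT p|round_prob. poly (cheb l) (x \<bullet> p) * r p) = 0" .
  qed
  then have "f x = c * (real m + 1)"
    using x by (simp add: r_def norm_eq_1 cheb_at_1)
  also have "\<dots> = harmonic_proj m f x"
    by (simp add: harmonic_proj_def zonal_kernel_def c_def mult.assoc)
  finally show ?thesis ..
qed

section \<open>Projections onto the eigenspaces\<close>

lemma continuous_on_harmonic_proj:
  assumes u: "continuous_on S3 u"
  shows "continuous_on S3 (harmonic_proj l u)"
  unfolding harmonic_proj_def[abs_def]
  by (rule continuous_on_integral_round_prob[OF compact_sphere])
    (auto simp: case_prod_beta intro!: continuous_intros continuous_on_compose2[OF u])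

lemma harmonic_proj_symmetric:
  assumes u: "continuous_on S3 u" and v: "continuous_on S3 v"
  shows "(LINT x|round_prob. harmonic_proj l u x * v x) = (LINT x|round_prob. u x * harmonic_proj l v x)"
proof -
  have "(LINT x|round_prob. harmonic_proj l u x * v x) = (LINT x|round_prob. LINT y|round_prob. zonal_kernel l x y * u y * v x)"
    by (simp add: harmonic_proj_def)
  also have "\<dots> = (LINT y|round_prob. LINT x|round_prob. zonal_kernel l x y * u y * v x)"
    by (rule Fubini_round_prob)
      (auto simp: case_prod_beta intro!: continuous_intros continuous_on_compose2[OF u] continuous_on_compose2[OF v])
  also have "\<dots> = (LINT x|round_prob. u x * harmonic_proj l v x)"
  proof (rule integral_round_prob_cong)
    fix y
    have "(LINT x|round_prob. zonal_kernel l x y * u y * v x) = (LINT x|round_prob. u y * (zonal_kernel l y x * v x))"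
      by (rule integral_round_prob_cong) (simp add: zonal_kernel_commute[of l _ y])
    then show "(LINT x|round_prob. zonal_kernel l x y * u y * v x) = u y * harmonic_proj l v y"
      by (simp add: harmonic_proj_def)
  qed
  finally show ?thesis .
qed

lemma harmonic_proj_proj:
  assumes u: "continuous_on S3 u" and x: "x \<in> S3"
  shows "harmonic_proj k (harmonic_proj l u) x = (if k = l then harmonic_proj l u x else 0)"
proof -
  have "harmonic_proj k (harmonic_proj l u) x = (LINT y|round_prob. LINT z|round_prob. zonal_kernel k x y * zonal_kernel l y z * u z)"
    by (simp add: harmonic_proj_def mult.assoc)
  also have "\<dots> = (LINT z|round_prob. LINT y|round_prob. zonal_kernel k x y * zonal_kernel l y z * u z)"
    by (rule Fubini_round_prob)
      (auto simp: case_prod_beta intro!: continuous_intros continuous_on_compose2[OF u])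
  also have "\<dots> = (LINT z|round_prob. (if k = l then zonal_kernel l x z * u z else 0))"
  proof (rule integral_round_prob_cong)
    fix z assume z: "z \<in> S3"
    let ?h = "\<lambda>y. poly (cheb l) (z \<bullet> y)"
    have "(LINT y|round_prob. zonal_kernel k x y * zonal_kernel l y z * u z) = (real l + 1) * u z * harmonic_proj k ?h x"
      unfolding harmonic_proj_def
      by (subst integral_mult_right_zero[symmetric]) (simp add: zonal_kernel_def inner_commute mult_ac)
    also have "harmonic_proj k ?h x = (if k = l then ?h x else 0)"
      using eigenfn_reproducing[OF eigenfn_zonal[OF z] x, of l]
        eigenfn_orthogonal_zonal[OF eigenfn_zonal[OF z] x, of k l]
      by (auto simp: harmonic_proj_def zonal_kernel_def mult.assoc)
    finally have "(LINT y|round_prob. zonal_kernel k x y * zonal_kernel l y z * u z) = (real l + 1) * u z * (if k = l then ?h x else 0)" .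
    moreover have "zonal_kernel l x z * u z = (real l + 1) * u z * ?h x"
      by (simp add: zonal_kernel_def inner_commute)
    ultimately show "(LINT y|round_prob. zonal_kernel k x y * zonal_kernel l y z * u z) = (if k = l then zonal_kernel l x z * u z else 0)"
      by (cases "k = l") (simp_all only: if_True if_False simp_thms mult_zero_right)
  qed
  also have "\<dots> = (if k = l then harmonic_proj l u x else 0)"
    by (simp add: harmonic_proj_def)
  finally show ?thesis .
qed

lemma harmonic_proj_diff:
  assumes "continuous_on S3 u" "continuous_on S3 v"
  shows "harmonic_proj l (\<lambda>p. u p - v p) x = harmonic_proj l u x - harmonic_proj l v x"
  unfolding harmonic_proj_def right_diff_distrib
  by (intro Bochner_Integration.integral_diff integrable_round_prob continuous_intros assms)

lemma harmonic_proj_sum: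
  assumes "\<And>k. k \<in> A \<Longrightarrow> continuous_on S3 (v k)"
  shows "harmonic_proj l (\<lambda>p. \<Sum>k\<in>A. c k * v k p) x = (\<Sum>k\<in>A. c k * harmonic_proj l (v k) x)"
proof -
  have "harmonic_proj l (\<lambda>p. \<Sum>k\<in>A. c k * v k p) x = (LINT y|round_prob. (\<Sum>k\<in>A. c k * (zonal_kernel l x y * v k y)))"
    by (simp add: harmonic_proj_def sum_distrib_left mult_ac)
  also have "\<dots> = (\<Sum>k\<in>A. c k * harmonic_proj l (v k) x)"
    unfolding harmonic_proj_def
    by (subst Bochner_Integration.integral_sum) (auto intro!: integrable_round_prob continuous_intros assms)
  finally show ?thesis .
qed

lemma integral_harmonic_proj_squared:
  assumes u: "continuous_on S3 u"
  shows "(LINT x|round_prob. (harmonic_proj l u x)\<^sup>2) = (LINT x|round_prob. u x * harmonic_proj l u x)"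
proof -
  have "(LINT x|round_prob. (harmonic_proj l u x)\<^sup>2) = (LINT x|round_prob. u x * harmonic_proj l (harmonic_proj l u) x)"
    unfolding power2_eq_square by (rule harmonic_proj_symmetric[OF u continuous_on_harmonic_proj[OF u]])
  also have "\<dots> = (LINT x|round_prob. u x * harmonic_proj l u x)"
    by (rule integral_round_prob_cong) (simp add: harmonic_proj_proj[OF u])
  finally show ?thesis .
qed

lemma harmonic_proj_weighted_sum:
  assumes u: "continuous_on S3 u" and A: "finite A" "l \<in> A" and x: "x \<in> S3"
  shows "harmonic_proj l (\<lambda>p. \<Sum>k\<in>A. c k * harmonic_proj k u p) x = c l * harmonic_proj l u x"
proof -
  have "harmonic_proj l (\<lambda>p. \<Sum>k\<in>A. c k * harmonic_proj k u p) x = (\<Sum>k\<in>A. c k * harmonic_proj l (harmonic_proj k u) x)"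
    by (rule harmonic_proj_sum) (rule continuous_on_harmonic_proj[OF u])
  also have "\<dots> = (\<Sum>k\<in>A. if k = l then c l * harmonic_proj l u x else 0)"
    by (intro sum.cong refl) (auto simp: harmonic_proj_proj[OF u x])
  finally have "harmonic_proj l (\<lambda>p. \<Sum>k\<in>A. c k * harmonic_proj k u p) x = \<dots>" .
  then show ?thesis using A by simp
qed

lemma integral_weighted_sum_harmonic_proj:
  assumes u: "continuous_on S3 u" and w: "continuous_on S3 w"
  shows "(LINT x|round_prob. w x * (\<Sum>k\<in>A. c k * harmonic_proj k u x)) = (\<Sum>k\<in>A. c k * (LINT x|round_prob. w x * harmonic_proj k u x))"
proof -
  have "(LINT x|round_prob. w x * (\<Sum>k\<in>A. c k * harmonic_proj k u x)) = (LINT x|round_prob. (\<Sum>k\<in>A. c k * (w x * harmonic_proj k u x)))"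
    by (simp add: sum_distrib_left mult_ac)
  also have "\<dots> = (\<Sum>k\<in>A. c k * (LINT x|round_prob. w x * harmonic_proj k u x))"
    by (subst Bochner_Integration.integral_sum)
      (auto intro!: integrable_round_prob continuous_intros continuous_on_harmonic_proj u w)
  finally show ?thesis .
qed

lemma Bessel_inequality:
  assumes u: "continuous_on S3 u" and A: "finite A"
  shows "(\<Sum>l\<in>A. LINT x|round_prob. (harmonic_proj l u x)\<^sup>2) \<le> (LINT x|round_prob. (u x)\<^sup>2)"
proof -
  define s where "s = (\<lambda>x. \<Sum>k\<in>A. 1 * harmonic_proj k u x)"
  have s: "continuous_on S3 s"
    unfolding s_def by (intro continuous_intros continuous_on_harmonic_proj u)
  let ?S = "\<Sum>l\<in>A. LINT x|round_prob. (harmonic_proj l u x)\<^sup>2"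
  have with_s: "(LINT x|round_prob. w x * s x) = (\<Sum>l\<in>A. LINT x|round_prob. w x * harmonic_proj l u x)"
    if "continuous_on S3 w" for w
    using integral_weighted_sum_harmonic_proj[OF u that, where c = "\<lambda>_. 1" and A = A] by (simp add: s_def)
  have us: "(LINT x|round_prob. u x * s x) = ?S"
    unfolding with_s[OF u] integral_harmonic_proj_squared[OF u] ..
  have "(LINT x|round_prob. s x * s x) = (\<Sum>l\<in>A. LINT x|round_prob. s x * harmonic_proj l u x)"
    by (rule with_s[OF s])
  also have "\<dots> = (\<Sum>l\<in>A. LINT x|round_prob. u x * harmonic_proj l u x)"
  proof (rule sum.cong[OF refl])
    fix l assume l: "l \<in> A"
    have "(LINT x|round_prob. s x * harmonic_proj l u x) = (LINT x|round_prob. harmonic_proj l s x * u x)"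
      by (rule harmonic_proj_symmetric[OF s u, symmetric])
    also have "\<dots> = (LINT x|round_prob. u x * harmonic_proj l u x)"
    proof (rule integral_round_prob_cong)
      fix x assume "x \<in> S3"
      then have "harmonic_proj l s x = 1 * harmonic_proj l u x"
        unfolding s_def by (rule harmonic_proj_weighted_sum[OF u A l])
      then show "harmonic_proj l s x * u x = u x * harmonic_proj l u x" by simp
    qed
    finally show "(LINT x|round_prob. s x * harmonic_proj l u x) = (LINT x|round_prob. u x * harmonic_proj l u x)" .
  qed
  also have "\<dots> = ?S" by (simp add: integral_harmonic_proj_squared[OF u])
  finally have ss: "(LINT x|round_prob. s x * s x) = ?S" .
  have "0 \<le> (LINT x|round_prob. (u x - s x)\<^sup>2)" by simp
  also have "\<dots> = (LINT x|round_prob. (u x)\<^sup>2 - 2 * (u x * s x) + s x * s x)"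
    by (simp add: power2_eq_square algebra_simps)
  also have "\<dots> = (LINT x|round_prob. (u x)\<^sup>2) - 2 * (LINT x|round_prob. u x * s x) + (LINT x|round_prob. s x * s x)"
    by (subst Bochner_Integration.integral_add Bochner_Integration.integral_diff integral_mult_right_zero;
          (intro integrable_round_prob continuous_intros u s)?)+ simp
  finally show ?thesis using us ss by simp
qed

section \<open>The product map and its adjoint\<close>

text \<open>
  The degrees that occur in the product of eigenfunctions of degrees \<open>m\<close> and \<open>n\<close>, for \<open>n \<le> m\<close>.
\<close>

definition product_degrees :: "nat \<Rightarrow> nat \<Rightarrow> nat set" where
  "product_degrees m n = (\<lambda>k. m + n - 2 * k) ` {..n}"

lemma finite_product_degrees [simp]: "finite (product_degrees m n)"
  by (simp add: product_degrees_def)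

lemma product_degrees_bounds: "l \<in> product_degrees m n \<Longrightarrow> m - n \<le> l \<and> l \<le> m + n"
  by (auto simp: product_degrees_def)

lemma zonal_kernel_mult:
  assumes "n \<le> m"
  shows "zonal_kernel m x y * zonal_kernel n x y =
    (\<Sum>l\<in>product_degrees m n. (real m + 1) * (real n + 1) / (real l + 1) * zonal_kernel l x y)"
proof -
  have "poly (cheb m) (x \<bullet> y) * poly (cheb n) (x \<bullet> y) = (\<Sum>k\<le>n. poly (cheb (m + n - 2 * k)) (x \<bullet> y))"
    using arg_cong[OF cheb_mult[OF assms], of "\<lambda>q. poly q (x \<bullet> y)"] by (simp add: poly_sum)
  also have "\<dots> = (\<Sum>l\<in>product_degrees m n. poly (cheb l) (x \<bullet> y))"
    unfolding product_degrees_def using assms by (subst sum.reindex) (auto simp: inj_on_def)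
  finally have "zonal_kernel m x y * zonal_kernel n x y = (real m + 1) * (real n + 1) * (\<Sum>l\<in>product_degrees m n. poly (cheb l) (x \<bullet> y))"
    by (simp add: zonal_kernel_def mult_ac)
  also have "\<dots> = (\<Sum>l\<in>product_degrees m n. (real m + 1) * (real n + 1) / (real l + 1) * zonal_kernel l x y)"
    unfolding sum_distrib_left
  proof (rule sum.cong[OF refl])
    fix l
    show "(real m + 1) * (real n + 1) * poly (cheb l) (x \<bullet> y) =
      (real m + 1) * (real n + 1) / (real l + 1) * zonal_kernel l x y"
      using of_nat_0_le_iff[of l, where 'a = real] by (simp add: zonal_kernel_def)
  qed
  finally show ?thesis .
qed

text \<open>
  The map that takes \<open>w\<close> to the function \<open>(y, z) \<mapsto> \<integral> K\<^sub>m(x, y) K\<^sub>n(x, z) w(x) dx\<close> is the adjoint of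
  \<open>f \<otimes> g \<mapsto> f g\<close>, where \<open>K\<^sub>l\<close> is the zonal kernel of degree \<open>l\<close>.  The squared norm of the
  image of \<open>w\<close> is \<open>\<integral>\<integral> w(x) w(x') K\<^sub>m(x, x') K\<^sub>n(x, x') dx dx'\<close> by the reproducing
  property, and \<open>zonal_kernel_mult\<close> makes this the sum on the right-hand side.  The proof treats the two variables \<open>y\<close> and \<open>z\<close> in turn, with one use of the
  Cauchy-Schwarz inequality for each.
\<close>

lemma bilinear_duality:
  assumes nm: "n \<le> m" and f: "eigenfn m f" and g: "eigenfn n g" and w: "continuous_on S3 w"
  shows "(LINT x|round_prob. f x * g x * w x)\<^sup>2 \<le> (LINT x|round_prob. (f x)\<^sup>2) * (LINT x|round_prob. (g x)\<^sup>2) *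
    (\<Sum>l\<in>product_degrees m n. (real m + 1) * (real n + 1) / (real l + 1) * (LINT x|round_prob. (harmonic_proj l w x)\<^sup>2))"
proof -
  note cf = eigenfn_continuous[OF f] and cg = eigenfn_continuous[OF g]
  have cgw: "continuous_on S3 (\<lambda>x. g x * w x)" by (intro continuous_intros cg w)
  define F where "F y x = zonal_kernel m x y * w x" for y x
  have cF: "continuous_on S3 (F y)" for y unfolding F_def by (intro continuous_intros w)
  have "(LINT x|round_prob. f x * g x * w x) = (LINT x|round_prob. harmonic_proj m f x * (g x * w x))"
    by (rule integral_round_prob_cong) (simp add: eigenfn_reproducing[OF f])
  also have "\<dots> = (LINT y|round_prob. f y * harmonic_proj m (\<lambda>x. g x * w x) y)"
    by (rule harmonic_proj_symmetric[OF cf cgw])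
  finally have 1: "(LINT x|round_prob. f x * g x * w x)\<^sup>2 \<le>
      (LINT x|round_prob. (f x)\<^sup>2) * (LINT y|round_prob. (harmonic_proj m (\<lambda>x. g x * w x) y)\<^sup>2)"
    using integral_round_prob_Cauchy_Schwarz[OF cf continuous_on_harmonic_proj[OF cgw]] by simp
  have 2: "(harmonic_proj m (\<lambda>x. g x * w x) y)\<^sup>2 \<le>
      (LINT x|round_prob. (g x)\<^sup>2) * (LINT x|round_prob. F y x * harmonic_proj n (F y) x)" for y
  proof -
    have "harmonic_proj m (\<lambda>x. g x * w x) y = (LINT x|round_prob. harmonic_proj n g x * F y x)"
      unfolding harmonic_proj_def[of m]
    proof (rule integral_round_prob_cong)
      fix x assume "x \<in> S3"
      then show "zonal_kernel m y x * (g x * w x) = harmonic_proj n g x * F y x"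
        by (simp add: F_def eigenfn_reproducing[OF g] zonal_kernel_commute[of m y x])
    qed
    also have "\<dots> = (LINT x|round_prob. g x * harmonic_proj n (F y) x)"
      by (rule harmonic_proj_symmetric[OF cg cF])
    finally show ?thesis
      using integral_round_prob_Cauchy_Schwarz[OF cg continuous_on_harmonic_proj[OF cF]]
      by (simp add: integral_harmonic_proj_squared[OF cF])
  qed
  define G where "G y x x' = zonal_kernel m x y * w x * zonal_kernel n x x' * zonal_kernel m x' y * w x'" for y x x'
  have cG: "continuous_on A (\<lambda>z. G (a z) (b z) (c z))"
    if "continuous_on A a" "continuous_on A b" "continuous_on A c" "b ` A \<subseteq> S3" "c ` A \<subseteq> S3"
    for A :: "'a::topological_space set" and a b c
    unfolding G_def by (intro continuous_intros continuous_on_compose2[OF w] that)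
  have Fint: "(LINT x|round_prob. F y x * harmonic_proj n (F y) x) = (LINT x|round_prob. LINT x'|round_prob. G y x x')" for y
  proof (rule integral_round_prob_cong)
    fix x
    have "(LINT x'|round_prob. G y x x') = (LINT x'|round_prob. F y x * (zonal_kernel n x x' * F y x'))"
      by (rule integral_round_prob_cong) (simp add: F_def G_def mult_ac)
    then show "F y x * harmonic_proj n (F y) x = (LINT x'|round_prob. G y x x')"
      by (simp add: harmonic_proj_def)
  qed
  have c2: "continuous_on (S3 \<times> S3) (\<lambda>(y, x). LINT x'|round_prob. G y x x')"
    unfolding case_prod_beta
    by (rule continuous_on_integral_round_prob) (auto simp: case_prod_beta intro!: compact_Times compact_sphere cG continuous_intros)
  have c1: "continuous_on S3 (\<lambda>y. LINT x|round_prob. LINT x'|round_prob. G y x x')"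
    by (rule continuous_on_integral_round_prob[OF compact_sphere c2])
  \<comment> \<open>Integrating over the outer variable first turns the two kernels of degree \<open>m\<close> into one.\<close>
  have "(LINT y|round_prob. (harmonic_proj m (\<lambda>x. g x * w x) y)\<^sup>2) \<le>
      (LINT y|round_prob. (LINT x|round_prob. (g x)\<^sup>2) * (LINT x|round_prob. LINT x'|round_prob. G y x x'))"
    using 2 unfolding Fint
    by (intro integral_mono integrable_round_prob continuous_intros continuous_on_harmonic_proj cgw c1)
  also have "\<dots> = (LINT x|round_prob. (g x)\<^sup>2) * (LINT y|round_prob. LINT x|round_prob. LINT x'|round_prob. G y x x')"
    by simp
  also have "(LINT y|round_prob. LINT x|round_prob. LINT x'|round_prob. G y x x') =
      (LINT x|round_prob. LINT y|round_prob. LINT x'|round_prob. G y x x')"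
    by (rule Fubini_round_prob[OF c2])
  also have "\<dots> = (LINT x|round_prob. LINT x'|round_prob. LINT y|round_prob. G y x x')"
    by (intro integral_round_prob_cong Fubini_round_prob)
       (auto simp: case_prod_beta intro!: cG continuous_intros)
  also have "\<dots> = (LINT x|round_prob. (\<Sum>l\<in>product_degrees m n. (real m + 1) * (real n + 1) / (real l + 1) * (w x * harmonic_proj l w x)))"
  proof (rule integral_round_prob_cong)
    fix x assume x: "x \<in> S3"
    have "(LINT x'|round_prob. LINT y|round_prob. G y x x') =
        (LINT x'|round_prob. w x * w x' * (zonal_kernel m x x' * zonal_kernel n x x'))"
    proof (rule integral_round_prob_cong)
      fix x' assume x': "x' \<in> S3"
      have "(LINT y|round_prob. G y x x') = w x * w x' * zonal_kernel n x x' * (LINT y|round_prob. zonal_kernel m x y * zonal_kernel m x' y)"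
        unfolding G_def
        by (subst integral_mult_right_zero[symmetric]) (simp add: mult_ac)
      also have "(LINT y|round_prob. zonal_kernel m x y * zonal_kernel m x' y) = zonal_kernel m x x'"
      proof -
        have "(LINT y|round_prob. zonal_kernel m x y * zonal_kernel m x' y) = (real m + 1) * harmonic_proj m (\<lambda>y. poly (cheb m) (x' \<bullet> y)) x"
          unfolding harmonic_proj_def
          by (subst integral_mult_right_zero[symmetric]) (simp add: zonal_kernel_def mult_ac)
        then show ?thesis
          using eigenfn_reproducing[OF eigenfn_zonal[OF x'] x, of m] by (simp add: zonal_kernel_def inner_commute)
      qed
      finally show "(LINT y|round_prob. G y x x') = w x * w x' * (zonal_kernel m x x' * zonal_kernel n x x')"
        by (simp add: mult_ac)
    qed
    also have "\<dots> = w x * (LINT x'|round_prob. (\<Sum>l\<in>product_degrees m n.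
        (real m + 1) * (real n + 1) / (real l + 1) * (zonal_kernel l x x' * w x')))"
      unfolding zonal_kernel_mult[OF nm]
      by (subst integral_mult_right_zero[symmetric]) (simp add: sum_distrib_left sum_distrib_right mult_ac)
    also have "\<dots> = w x * (\<Sum>l\<in>product_degrees m n. (real m + 1) * (real n + 1) / (real l + 1) * harmonic_proj l w x)"
      unfolding harmonic_proj_def
      by (subst Bochner_Integration.integral_sum) (auto intro!: integrable_round_prob continuous_intros w)
    finally show "(LINT x'|round_prob. LINT y|round_prob. G y x x') =
        (\<Sum>l\<in>product_degrees m n. (real m + 1) * (real n + 1) / (real l + 1) * (w x * harmonic_proj l w x))"
      by (simp add: sum_distrib_left mult_ac)
  qed
  also have "\<dots> = (\<Sum>l\<in>product_degrees m n. (real m + 1) * (real n + 1) / (real l + 1) * (LINT x|round_prob. (harmonic_proj l w x)\<^sup>2))"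
    unfolding integral_harmonic_proj_squared[OF w]
    by (subst Bochner_Integration.integral_sum)
      (auto intro!: integrable_round_prob continuous_intros w continuous_on_harmonic_proj simp del: times_divide_eq_left)
  finally have 3: "(LINT y|round_prob. (harmonic_proj m (\<lambda>x. g x * w x) y)\<^sup>2) \<le> (LINT x|round_prob. (g x)\<^sup>2) *
     (\<Sum>l\<in>product_degrees m n. (real m + 1) * (real n + 1) / (real l + 1) * (LINT x|round_prob. (harmonic_proj l w x)\<^sup>2))" .
  show ?thesis
    using order_trans[OF 1 mult_left_mono[OF 3]] by (simp add: mult.assoc)
qed

section \<open>The bilinear estimate for real eigenfunctions\<close>

text \<open>
  Duality with \<open>w = f g\<close>.  The degrees of \<open>f g\<close> are at least \<open>m - n\<close>, so the multiplier in
  \<open>bilinear_duality\<close> is at most \<open>2 (n + 1)\<close>, and the Bessel inequality bounds the remaining sum by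
  \<open>\<integral> (f g)\<^sup>2\<close>, one power of which cancels.
\<close>

lemma bilinear_separated:
  assumes nm: "2 * n \<le> m + 1" "n \<le> m" and f: "eigenfn m f" and g: "eigenfn n g"
  shows "(LINT x|round_prob. (f x)\<^sup>2 * (g x)\<^sup>2) \<le>
    2 * (real n + 1) * (LINT x|round_prob. (f x)\<^sup>2) * (LINT x|round_prob. (g x)\<^sup>2)"
proof -
  let ?A = "LINT x|round_prob. (f x)\<^sup>2" and ?B = "LINT x|round_prob. (g x)\<^sup>2"
  let ?X = "LINT x|round_prob. (f x)\<^sup>2 * (g x)\<^sup>2"
  define u where "u x = f x * g x" for x
  have cu: "continuous_on S3 u"
    unfolding u_def by (intro continuous_intros eigenfn_continuous[OF f] eigenfn_continuous[OF g])
  have X: "?X = (LINT x|round_prob. (u x)\<^sup>2)" "?X = (LINT x|round_prob. f x * g x * u x)"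
    by (simp_all add: u_def power_mult_distrib power2_eq_square mult_ac)
  have AB: "0 \<le> ?A * ?B" by (intro mult_nonneg_nonneg) auto
  have X0: "0 \<le> ?X" by simp
  have "?X\<^sup>2 \<le> ?A * ?B *
      (\<Sum>l\<in>product_degrees m n. (real m + 1) * (real n + 1) / (real l + 1) * (LINT x|round_prob. (harmonic_proj l u x)\<^sup>2))"
    unfolding X(2) by (rule bilinear_duality[OF nm(2) f g cu])
  also have "\<dots> \<le> ?A * ?B * (\<Sum>l\<in>product_degrees m n. 2 * (real n + 1) * (LINT x|round_prob. (harmonic_proj l u x)\<^sup>2))"
  proof (intro mult_left_mono[OF _ AB] sum_mono mult_right_mono)
    fix l assume "l \<in> product_degrees m n"
    from product_degrees_bounds[OF this] nm have "m + 1 \<le> 2 * (l + 1)"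
      by arith
    then have "real m + 1 \<le> 2 * (real l + 1)"
      using of_nat_mono[of "m + 1" "2 * (l + 1)", where 'a = real] by simp
    then have le: "(real m + 1) * (real n + 1) \<le> 2 * (real l + 1) * (real n + 1)"
      by (rule mult_right_mono) simp
    have "0 < real l + 1" by simp
    from le show "(real m + 1) * (real n + 1) / (real l + 1) \<le> 2 * (real n + 1)"
      unfolding pos_divide_le_eq[OF \<open>0 < real l + 1\<close>] by (simp only: mult_ac)
  qed simp
  also have "\<dots> \<le> ?A * ?B * (2 * (real n + 1) * ?X)"
    unfolding X(1) sum_distrib_left[symmetric]
    by (intro mult_left_mono[OF _ AB] mult_left_mono Bessel_inequality cu) auto
  finally have "?X * ?X \<le> (2 * (real n + 1) * ?A * ?B) * ?X"
    by (simp add: power2_eq_square mult_ac)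
  then show ?thesis
  proof (cases "?X = 0")
    case True
    have "0 \<le> 2 * (real n + 1) * (?A * ?B)" using AB by (intro mult_nonneg_nonneg) auto
    then show ?thesis unfolding True by (simp only: mult.assoc)
  next
    case False
    with X0 have "0 < ?X" by linarith
    with \<open>?X * ?X \<le> _\<close> show ?thesis by (rule mult_right_le_imp_le)
  qed
qed

text \<open>
  The difference \<open>v\<close> of both sides has no component in the degrees \<open>product_degrees m n\<close>.  Duality with \<open>w = v\<close>
  therefore gives \<open>\<integral> f g v = 0\<close>.  Being orthogonal to the right-hand side too, \<open>v\<close> is orthogonal to
  itself.
\<close>

lemma product_spectrum:
  assumes nm: "n \<le> m" and f: "eigenfn m f" and g: "eigenfn n g" and x: "x \<in> S3"
  shows "f x * g x = (\<Sum>l\<in>product_degrees m n. harmonic_proj l (\<lambda>p. f p * g p) x)"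
proof -
  define u where "u = (\<lambda>p. f p * g p)"
  have cu: "continuous_on S3 u"
    unfolding u_def by (intro continuous_intros eigenfn_continuous[OF f] eigenfn_continuous[OF g])
  define s where "s = (\<lambda>p. \<Sum>l\<in>product_degrees m n. 1 * harmonic_proj l u p)"
  have cs: "continuous_on S3 s"
    unfolding s_def by (intro continuous_intros continuous_on_harmonic_proj cu)
  define v where "v = (\<lambda>p. u p - s p)"
  have cv: "continuous_on S3 v" unfolding v_def by (intro continuous_intros cu cs)
  have pv: "harmonic_proj l v p = 0" if "l \<in> product_degrees m n" "p \<in> S3" for l p
  proof -
    have "harmonic_proj l v p = harmonic_proj l u p - harmonic_proj l s p"
      unfolding v_def by (rule harmonic_proj_diff[OF cu cs])
    also have "harmonic_proj l s p = 1 * harmonic_proj l u p"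
      unfolding s_def by (rule harmonic_proj_weighted_sum[OF cu finite_product_degrees that])
    finally show ?thesis by simp
  qed
  have pv2: "(LINT p|round_prob. (harmonic_proj l v p)\<^sup>2) = 0" if "l \<in> product_degrees m n" for l
    using integral_round_prob_cong[of "\<lambda>p. (harmonic_proj l v p)\<^sup>2" "\<lambda>_. 0"] pv[OF that] by simp
  have "(LINT p|round_prob. u p * v p)\<^sup>2 \<le> (LINT p|round_prob. (f p)\<^sup>2) * (LINT p|round_prob. (g p)\<^sup>2) *
      (\<Sum>l\<in>product_degrees m n. (real m + 1) * (real n + 1) / (real l + 1) * (LINT p|round_prob. (harmonic_proj l v p)\<^sup>2))"
    unfolding u_def by (rule bilinear_duality[OF nm f g cv])
  also have "\<dots> = 0" by (simp add: pv2)
  finally have uv: "(LINT p|round_prob. u p * v p) = 0" by simp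
  have "(LINT p|round_prob. v p * s p) = (\<Sum>l\<in>product_degrees m n. 1 * (LINT p|round_prob. v p * harmonic_proj l u p))"
    unfolding s_def by (rule integral_weighted_sum_harmonic_proj[OF cu cv])
  also have "\<dots> = (\<Sum>l\<in>product_degrees m n. 1 * 0)"
  proof (intro sum.cong refl arg_cong[where f = "\<lambda>t. 1 * t"])
    fix l assume l: "l \<in> product_degrees m n"
    have "(LINT p|round_prob. v p * harmonic_proj l u p) = (LINT p|round_prob. harmonic_proj l v p * u p)"
      by (rule harmonic_proj_symmetric[OF cv cu, symmetric])
    also have "\<dots> = (LINT p|round_prob. 0)"
      by (rule integral_round_prob_cong) (simp add: pv[OF l])
    finally show "(LINT p|round_prob. v p * harmonic_proj l u p) = 0" by simp
  qed
  finally have vs: "(LINT p|round_prob. v p * s p) = 0" by simp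
  have "(LINT p|round_prob. (v p)\<^sup>2) = (LINT p|round_prob. u p * v p - v p * s p)"
    by (simp add: v_def power2_eq_square algebra_simps)
  also have "\<dots> = 0"
    by (subst Bochner_Integration.integral_diff) (auto intro!: integrable_round_prob continuous_intros cu cv cs simp: uv vs)
  finally have vv: "(LINT p|round_prob. (v p)\<^sup>2) = 0" .
  have "v x = 0"
  proof (rule zero_if_orthogonal_to_zonal[OF cv x])
    fix l
    have "(LINT p|round_prob. poly (cheb l) (x \<bullet> p) * v p)\<^sup>2 \<le> (LINT p|round_prob. (poly (cheb l) (x \<bullet> p))\<^sup>2) * (LINT p|round_prob. (v p)\<^sup>2)"
      by (intro integral_round_prob_Cauchy_Schwarz continuous_intros cv)
    then show "(LINT p|round_prob. poly (cheb l) (x \<bullet> p) * v p) = 0" by (simp add: vv)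
  qed
  then show ?thesis by (simp add: v_def s_def u_def)
qed

text \<open>
  Duality with \<open>g = f\<close> and \<open>w = \<Sum>l. (l + 1) P\<^sub>l (f\<^sup>2)\<close>.  With this choice both the pairing
  \<open>\<integral> f\<^sup>2 w\<close> and the sum on the right of \<open>bilinear_duality\<close> become multiples of the left-hand side \<open>S\<close>, so
  that \<open>S\<^sup>2 \<le> (m + 1)\<^sup>2 (\<integral> f\<^sup>2)\<^sup>2 S\<close>.
\<close>

lemma square_weighted_spectrum:
  assumes f: "eigenfn m f"
  shows "(\<Sum>l\<in>product_degrees m m. (real l + 1) * (LINT x|round_prob. (harmonic_proj l (\<lambda>p. (f p)\<^sup>2) x)\<^sup>2)) \<le>
    (real m + 1)\<^sup>2 * (LINT x|round_prob. (f x)\<^sup>2)\<^sup>2" (is "?S \<le> _")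
proof -
  let ?A = "LINT x|round_prob. (f x)\<^sup>2"
  define u where "u = (\<lambda>p. (f p)\<^sup>2)"
  have cu: "continuous_on S3 u"
    unfolding u_def by (intro continuous_intros eigenfn_continuous[OF f])
  define w where "w = (\<lambda>p. \<Sum>l\<in>product_degrees m m. (real l + 1) * harmonic_proj l u p)"
  have cw: "continuous_on S3 w"
    unfolding w_def by (intro continuous_intros continuous_on_harmonic_proj cu)
  have S: "?S = (\<Sum>l\<in>product_degrees m m. (real l + 1) * (LINT x|round_prob. (harmonic_proj l u x)\<^sup>2))"
    by (simp add: u_def)
  have "(LINT x|round_prob. u x * w x) = ?S"
    unfolding w_def integral_weighted_sum_harmonic_proj[OF cu cu] S integral_harmonic_proj_squared[OF cu] ..
  then have uw: "(LINT x|round_prob. f x * f x * w x) = ?S"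
    by (simp add: u_def power2_eq_square)
  have pw: "(LINT x|round_prob. (harmonic_proj l w x)\<^sup>2) = (real l + 1)\<^sup>2 * (LINT x|round_prob. (harmonic_proj l u x)\<^sup>2)"
    if l: "l \<in> product_degrees m m" for l
  proof -
    have "(LINT x|round_prob. (harmonic_proj l w x)\<^sup>2) = (LINT x|round_prob. (real l + 1)\<^sup>2 * (harmonic_proj l u x)\<^sup>2)"
    proof (rule integral_round_prob_cong)
      fix x assume "x \<in> S3"
      then have "harmonic_proj l w x = (real l + 1) * harmonic_proj l u x"
        unfolding w_def by (rule harmonic_proj_weighted_sum[OF cu finite_product_degrees l])
      then show "(harmonic_proj l w x)\<^sup>2 = (real l + 1)\<^sup>2 * (harmonic_proj l u x)\<^sup>2" by (simp add: power_mult_distrib)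
    qed
    then show ?thesis by simp
  qed
  have "?S\<^sup>2 \<le> ?A * ?A *
      (\<Sum>l\<in>product_degrees m m. (real m + 1) * (real m + 1) / (real l + 1) * (LINT x|round_prob. (harmonic_proj l w x)\<^sup>2))"
    unfolding uw[symmetric] by (rule bilinear_duality[OF order_refl f f cw])
  also have "(\<Sum>l\<in>product_degrees m m. (real m + 1) * (real m + 1) / (real l + 1) * (LINT x|round_prob. (harmonic_proj l w x)\<^sup>2)) =
      (\<Sum>l\<in>product_degrees m m. (real m + 1)\<^sup>2 * ((real l + 1) * (LINT x|round_prob. (harmonic_proj l u x)\<^sup>2)))"
  proof (rule sum.cong[OF refl])
    have cancel: "b * b / a * (a\<^sup>2 * N) = b\<^sup>2 * (a * N)" if "a \<noteq> 0" for a b N :: real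
      using that by (simp add: power2_eq_square)
    fix l assume "l \<in> product_degrees m m"
    have "real l + 1 \<noteq> 0" using of_nat_0_le_iff[of l, where 'a = real] by linarith
    then show "(real m + 1) * (real m + 1) / (real l + 1) * (LINT x|round_prob. (harmonic_proj l w x)\<^sup>2) =
        (real m + 1)\<^sup>2 * ((real l + 1) * (LINT x|round_prob. (harmonic_proj l u x)\<^sup>2))"
      unfolding pw[OF \<open>l \<in> product_degrees m m\<close>] by (rule cancel)
  qed
  also have "\<dots> = (real m + 1)\<^sup>2 * ?S"
    unfolding S by (simp add: sum_distrib_left)
  finally have *: "?S * ?S \<le> ((real m + 1)\<^sup>2 * ?A\<^sup>2) * ?S"
    by (simp add: power2_eq_square mult_ac)
  have S0: "0 \<le> ?S" by (intro sum_nonneg mult_nonneg_nonneg) auto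
  show ?thesis
  proof (cases "?S = 0")
    case True
    show ?thesis unfolding True by simp
  next
    case False
    then have "0 < ?S" using S0 by simp
    with * show ?thesis by (rule mult_right_le_imp_le)
  qed
qed

lemma harmonic_proj_laplacian:
  assumes u: "has_laplacian u v" and x: "x \<in> S3"
  shows "harmonic_proj l v x = - (real l * (real l + 2)) * harmonic_proj l u x"
proof -
  have "(LINT p|round_prob. v p * poly (cheb l) (x \<bullet> p)) =
      (LINT p|round_prob. u p * (- (real l * (real l + 2)) * poly (cheb l) (x \<bullet> p)))"
    by (rule Green[OF u has_laplacian_zonal_cheb[OF x]])
  then have "(real l + 1) * (LINT p|round_prob. v p * poly (cheb l) (x \<bullet> p)) =
      (real l + 1) * (LINT p|round_prob. u p * (- (real l * (real l + 2)) * poly (cheb l) (x \<bullet> p)))"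
    by simp
  also have "(real l + 1) * (LINT p|round_prob. v p * poly (cheb l) (x \<bullet> p)) = harmonic_proj l v x"
    unfolding harmonic_proj_def by (subst integral_mult_right_zero[symmetric]) (simp add: zonal_kernel_def mult_ac)
  also have "(real l + 1) * (LINT p|round_prob. u p * (- (real l * (real l + 2)) * poly (cheb l) (x \<bullet> p))) =
      - (real l * (real l + 2)) * harmonic_proj l u x"
    unfolding harmonic_proj_def by (subst (1 2) integral_mult_right_zero[symmetric]) (simp add: zonal_kernel_def mult_ac)
  finally show ?thesis .
qed

text \<open>
  Both sides equal \<open>12 Q\<close> with \<open>Q = \<integral> f\<^sup>2 |\<nabla>f|\<^sup>2\<close>.  On the left, pair the eigenvalue equation with
  \<open>f\<^sup>3\<close>, whose gradient is \<open>3 f\<^sup>2 \<nabla>f\<close>.  On the right, the sum is the Dirichlet energy of \<open>f\<^sup>2\<close>, whose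
  gradient is \<open>2 f \<nabla>f\<close>.
\<close>

lemma fourth_moment_identity:
  assumes f: "eigenfn m f"
  shows "4 * (real m * (real m + 2)) * (LINT x|round_prob. (f x) ^ 4) =
    3 * (\<Sum>l\<in>product_degrees m m. real l * (real l + 2) * (LINT x|round_prob. (harmonic_proj l (\<lambda>p. (f p)\<^sup>2) x)\<^sup>2))"
proof -
  let ?lam = "\<lambda>l. real l * (real l + 2)"
  obtain f1 f2 where f1: "\<And>a. rot_deriv a f (f1 a)" and f2: "\<And>a. rot_deriv a (f1 a) (f2 a)"
    and lap: "\<And>p. p \<in> S3 \<Longrightarrow> - ?lam m * f p = (\<Sum>a\<in>UNIV. f2 a p)"
    using f unfolding eigenfn_def has_laplacian_def by blast
  define u where "u = (\<lambda>p. f p * f p)"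
  define u1 where "u1 a p = f1 a p * f p + f p * f1 a p" for a p
  define u2 where "u2 a p = (f2 a p * f p + f1 a p * f1 a p) + (f1 a p * f1 a p + f p * f2 a p)" for a p
  define L where "L p = (\<Sum>a\<in>UNIV. u2 a p)" for p
  have u1: "rot_deriv a u (u1 a)" for a
    unfolding u_def u1_def[abs_def] by (intro rot_deriv_mult f1)
  have u2: "rot_deriv a (u1 a) (u2 a)" for a
    unfolding u1_def[abs_def] u2_def[abs_def] by (intro rot_deriv_add rot_deriv_mult f1 f2)
  have uL: "has_laplacian u L"
    unfolding has_laplacian_def L_def using u1 u2 by blast
  have cu: "continuous_on S3 u" and cL: "continuous_on S3 L"
    using has_laplacian_continuous[OF uL] by auto
  define Q where "Q = (\<Sum>a\<in>UNIV. LINT p|round_prob. (f p)\<^sup>2 * (f1 a p)\<^sup>2)"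
  have "(LINT p|round_prob. L p * u p) = - (\<Sum>a\<in>UNIV. LINT p|round_prob. u1 a p * u1 a p)"
    unfolding L_def by (rule Dirichlet_form[OF u1 u2 u1])
  also have "(\<Sum>a\<in>UNIV. LINT p|round_prob. u1 a p * u1 a p) = (\<Sum>a\<in>UNIV. LINT p|round_prob. 4 * ((f p)\<^sup>2 * (f1 a p)\<^sup>2))"
    by (simp add: u1_def power2_eq_square mult_ac)
  also have "\<dots> = 4 * Q"
    unfolding Q_def by (simp add: sum_distrib_left)
  finally have LQ: "(LINT p|round_prob. L p * u p) = - (4 * Q)" .
  have "(LINT p|round_prob. (\<Sum>a\<in>UNIV. f2 a p) * (u p * f p)) =
      - (\<Sum>a\<in>UNIV. LINT p|round_prob. f1 a p * (u1 a p * f p + u p * f1 a p))"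
    by (rule Dirichlet_form[OF f1 f2 rot_deriv_mult[OF u1 f1]])
  also have "(\<Sum>a\<in>UNIV. LINT p|round_prob. f1 a p * (u1 a p * f p + u p * f1 a p)) =
      (\<Sum>a\<in>UNIV. LINT p|round_prob. 3 * ((f p)\<^sup>2 * (f1 a p)\<^sup>2))"
    by (simp add: u_def u1_def power2_eq_square algebra_simps)
  also have "\<dots> = 3 * Q"
    unfolding Q_def by (simp add: sum_distrib_left)
  also have "(LINT p|round_prob. (\<Sum>a\<in>UNIV. f2 a p) * (u p * f p)) = (LINT p|round_prob. - ?lam m * (f p) ^ 4)"
    by (rule integral_round_prob_cong) (simp add: u_def power4_eq_xxxx mult_ac flip: lap)
  finally have "?lam m * (LINT p|round_prob. (f p) ^ 4) = 3 * Q"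
    by simp
  then have Q: "4 * ?lam m * (LINT p|round_prob. (f p) ^ 4) = 3 * (4 * Q)" by simp
  have "(LINT p|round_prob. L p * u p) = (LINT p|round_prob. L p * (\<Sum>l\<in>product_degrees m m. 1 * harmonic_proj l u p))"
    by (rule integral_round_prob_cong) (simp add: product_spectrum[OF order_refl f f, folded u_def] u_def)
  also have "\<dots> = (\<Sum>l\<in>product_degrees m m. 1 * (LINT p|round_prob. L p * harmonic_proj l u p))"
    by (rule integral_weighted_sum_harmonic_proj[OF cu cL])
  also have "\<dots> = (\<Sum>l\<in>product_degrees m m. - ?lam l * (LINT p|round_prob. (harmonic_proj l u p)\<^sup>2))"
  proof (rule sum.cong[OF refl])
    fix l
    have "(LINT p|round_prob. L p * harmonic_proj l u p) = (LINT p|round_prob. harmonic_proj l L p * u p)"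
      by (rule harmonic_proj_symmetric[OF cL cu, symmetric])
    also have "\<dots> = (LINT p|round_prob. - ?lam l * (u p * harmonic_proj l u p))"
      by (rule integral_round_prob_cong) (simp add: harmonic_proj_laplacian[OF uL])
    also have "\<dots> = - ?lam l * (LINT p|round_prob. (harmonic_proj l u p)\<^sup>2)"
      unfolding integral_harmonic_proj_squared[OF cu] by (rule integral_mult_right_zero)
    finally show "1 * (LINT p|round_prob. L p * harmonic_proj l u p) = - ?lam l * (LINT p|round_prob. (harmonic_proj l u p)\<^sup>2)" by simp
  qed
  also have "\<dots> = - (\<Sum>l\<in>product_degrees m m. ?lam l * (LINT p|round_prob. (harmonic_proj l u p)\<^sup>2))"
    by (simp add: sum_negf)
  finally have "4 * Q = (\<Sum>l\<in>product_degrees m m. ?lam l * (LINT p|round_prob. (harmonic_proj l u p)\<^sup>2))"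
    using LQ by simp
  then show ?thesis
    unfolding Q by (simp add: u_def power2_eq_square)
qed

text \<open>
  In the fourth moment identity, \<open>l (l + 2) \<le> (2m + 1) (l + 1)\<close> because \<open>l \<le> 2m\<close>.
\<close>

lemma eigenfn_L4:
  assumes f: "eigenfn m f" and m: "1 \<le> m"
  shows "(LINT x|round_prob. (f x) ^ 4) \<le> (2 * real m + 1) * (LINT x|round_prob. (f x)\<^sup>2)\<^sup>2"
proof -
  let ?X = "LINT x|round_prob. (f x) ^ 4" and ?A = "LINT x|round_prob. (f x)\<^sup>2"
  let ?N = "\<lambda>l. LINT x|round_prob. (harmonic_proj l (\<lambda>p. (f p)\<^sup>2) x)\<^sup>2"
  have lam: "real m * (real m + 2) > 0" using m by simp
  have "4 * (real m * (real m + 2)) * ?X = 3 * (\<Sum>l\<in>product_degrees m m. real l * (real l + 2) * ?N l)"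
    by (rule fourth_moment_identity[OF f])
  also have "\<dots> \<le> 3 * (\<Sum>l\<in>product_degrees m m. (2 * real m + 1) * ((real l + 1) * ?N l))"
  proof (intro mult_left_mono sum_mono)
    fix l assume "l \<in> product_degrees m m"
    then have "real l \<le> 2 * real m"
      using product_degrees_bounds[of l m m] of_nat_mono[of l "m + m", where 'a = real] by simp
    then have "(real l + 1) * (real l + 1) \<le> (2 * real m + 1) * (real l + 1)"
      by (intro mult_right_mono) auto
    then have "real l * (real l + 2) \<le> (2 * real m + 1) * (real l + 1)"
      by (simp add: algebra_simps)
    then show "real l * (real l + 2) * ?N l \<le> (2 * real m + 1) * ((real l + 1) * ?N l)"
      by (simp only: mult.assoc[symmetric]) (intro mult_right_mono, auto)
  qed simp
  also have "\<dots> \<le> 3 * ((2 * real m + 1) * ((real m + 1)\<^sup>2 * ?A\<^sup>2))"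
    unfolding sum_distrib_left[symmetric]
    by (intro mult_left_mono square_weighted_spectrum f) auto
  also have "\<dots> = (3 * (real m + 1)\<^sup>2) * ((2 * real m + 1) * ?A\<^sup>2)" by simp
  also have "\<dots> \<le> (4 * (real m * (real m + 2))) * ((2 * real m + 1) * ?A\<^sup>2)"
  proof (intro mult_right_mono)
    have "real m * real m \<ge> 1" using m mult_mono[of 1 "real m" 1 "real m"] by simp
    then show "3 * (real m + 1)\<^sup>2 \<le> 4 * (real m * (real m + 2))"
      using m by (simp add: power2_eq_square algebra_simps)
  qed auto
  finally show ?thesis
    by (rule mult_left_le_imp_le) (use lam in simp)
qed

text \<open>
  For \<open>2n \<le> m + 1\<close> this is the separated case; otherwise \<open>m + 2 \<le> 2n\<close>, both degrees are positive, and the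
  two fourth moments are combined by the Cauchy-Schwarz inequality.
\<close>

lemma bilinear_real:
  assumes nm: "n \<le> m" and f: "eigenfn m f" and g: "eigenfn n g"
  shows "(LINT x|round_prob. (f x)\<^sup>2 * (g x)\<^sup>2) \<le>
    3 * (real n + 1) * ((LINT x|round_prob. (f x)\<^sup>2) * (LINT x|round_prob. (g x)\<^sup>2))"
proof -
  let ?A = "LINT x|round_prob. (f x)\<^sup>2" and ?B = "LINT x|round_prob. (g x)\<^sup>2"
  have A0: "0 \<le> ?A" and B0: "0 \<le> ?B" by auto
  show ?thesis
  proof (cases "2 * n \<le> m + 1")
    case True
    have "(LINT x|round_prob. (f x)\<^sup>2 * (g x)\<^sup>2) \<le> (2 * (real n + 1)) * (?A * ?B)"
      using bilinear_separated[OF True nm f g] by (simp only: mult.assoc)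
    also have "\<dots> \<le> 3 * (real n + 1) * (?A * ?B)"
      using A0 B0 by (intro mult_right_mono mult_nonneg_nonneg) auto
    finally show ?thesis .
  next
    case False
    then have n1: "1 \<le> n" and m1: "1 \<le> m" and mn: "m + 2 \<le> 2 * n" using nm by auto
    have mn': "real m + 2 \<le> 2 * real n"
      using of_nat_mono[OF mn, where 'a = real] by simp
    have "(LINT x|round_prob. (f x)\<^sup>2 * (g x)\<^sup>2)\<^sup>2 \<le>
        (LINT x|round_prob. ((f x)\<^sup>2)\<^sup>2) * (LINT x|round_prob. ((g x)\<^sup>2)\<^sup>2)"
      by (intro integral_round_prob_Cauchy_Schwarz continuous_intros eigenfn_continuous[OF f] eigenfn_continuous[OF g])
    also have "\<dots> = (LINT x|round_prob. (f x) ^ 4) * (LINT x|round_prob. (g x) ^ 4)"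
      by simp
    also have "\<dots> \<le> ((2 * real m + 1) * ?A\<^sup>2) * ((2 * real n + 1) * ?B\<^sup>2)"
      by (intro mult_mono eigenfn_L4 f g n1 m1) (auto intro!: mult_nonneg_nonneg)
    also have "\<dots> = ((2 * real m + 1) * (2 * real n + 1)) * (?A * ?B)\<^sup>2"
      by (simp add: power_mult_distrib mult_ac)
    also have "\<dots> \<le> (3 * (real n + 1))\<^sup>2 * (?A * ?B)\<^sup>2"
    proof (intro mult_right_mono)
      have "(2 * real m + 1) * (2 * real n + 1) \<le> (4 * real n - 3) * (2 * real n + 1)"
        using mn' by (intro mult_right_mono) auto
      also have "\<dots> \<le> (3 * (real n + 1))\<^sup>2"
        by (simp add: power2_eq_square algebra_simps)
      finally show "(2 * real m + 1) * (2 * real n + 1) \<le> (3 * (real n + 1))\<^sup>2" .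
    qed auto
    also have "\<dots> = (3 * (real n + 1) * (?A * ?B))\<^sup>2"
      by (simp add: power_mult_distrib)
    finally show ?thesis
      by (rule power2_le_imp_le) (use A0 B0 in \<open>intro mult_nonneg_nonneg; simp\<close>)
  qed
qed

section \<open>Passage to classical eigenfunctions\<close>

lemma sphere_differential_linear:
  assumes u: "u differentiable_on sphere 0 1" and p: "p \<in> sphere 0 1"
  shows "linear (sphere_differential u p)"
proof -
  have "(u has_derivative frechet_derivative u (at p within sphere 0 1)) (at p within sphere 0 1)"
    using u p by (simp add: differentiable_on_def frechet_derivative_works)
  from has_derivative_linear[OF this] have D: "linear (frechet_derivative u (at p within sphere 0 1))" .
  have "linear (tangent_proj p)"
    by (rule linearI) (simp_all add: tangent_proj_def inner_add_right algebra_simps)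
  from linear_compose[OF this D] show ?thesis
    by (simp add: sphere_differential_def[abs_def] o_def)
qed

lemma sphere_differential_expansion:
  assumes u: "u differentiable_on sphere 0 1" and p: "p \<in> sphere 0 1"
  shows "sphere_differential u p v = (\<Sum>k\<in>UNIV. v $ k *\<^sub>R sphere_differential u p (axis k 1))"
proof -
  have "v = (\<Sum>k\<in>UNIV. v $ k *\<^sub>R axis k 1)"
    using basis_expansion[of v] by (simp add: scalar_mult_eq_scaleR)
  then have "sphere_differential u p v = sphere_differential u p (\<Sum>k\<in>UNIV. v $ k *\<^sub>R axis k 1)"
    by simp
  also have "\<dots> = (\<Sum>k\<in>UNIV. v $ k *\<^sub>R sphere_differential u p (axis k 1))"
    by (simp add: linear_sum[OF sphere_differential_linear[OF u p]] linear_cmul[OF sphere_differential_linear[OF u p]])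
  finally show ?thesis .
qed

lemma sphere_differential_normal:
  assumes u: "u differentiable_on sphere 0 1" and p: "p \<in> sphere 0 1"
  shows "sphere_differential u p p = 0"
proof -
  have "tangent_proj p p = tangent_proj p 0" using p by (simp add: tangent_proj_def norm_eq_1)
  then have "sphere_differential u p p = sphere_differential u p 0"
    by (simp add: sphere_differential_def)
  then show ?thesis using linear_0[OF sphere_differential_linear[OF u p]] by simp
qed

text \<open>
  The velocity of \<open>t \<mapsto> rot a t p\<close> at time \<open>0\<close> is the tangent vector \<open>quat a p\<close>.
\<close>

lemma rot_has_vector_derivative:
  assumes u: "u differentiable_on S3" and p: "p \<in> S3"
  shows "((\<lambda>t. u (rot a t p)) has_vector_derivative sphere_differential u p (quat a p)) (at 0)"
proof -
  let ?D = "frechet_derivative u (at p within S3)"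
  have D: "(u has_derivative ?D) (at p within S3)"
    using u p by (simp add: differentiable_on_def frechet_derivative_works)
  have g: "((\<lambda>t. rot a t p) has_derivative (\<lambda>t. t *\<^sub>R quat a p)) (at 0)"
    unfolding rot_def by (auto intro!: derivative_eq_intros)
  have "range (\<lambda>t. rot a t p) \<subseteq> S3" using p by auto
  from diff_chain_within[OF g, of u ?D] has_derivative_subset[OF D this]
  have "(u \<circ> (\<lambda>t. rot a t p) has_derivative ?D \<circ> (\<lambda>t. t *\<^sub>R quat a p)) (at 0)"
    by simp
  moreover have "?D (t *\<^sub>R quat a p) = t *\<^sub>R sphere_differential u p (quat a p)" for t
    using linear_cmul[OF has_derivative_linear[OF D]]
    by (simp add: sphere_differential_def tangent_proj_def)
  ultimately show ?thesis
    by (simp add: has_vector_derivative_def o_def)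
qed

text \<open>
  Along \<open>t \<mapsto> rot a t p\<close> the function has derivative \<open>G \<bullet> quat a p\<close>, where \<open>G\<close> is the gradient.  Differentiating
  once more produces \<open>- G \<bullet> p = 0\<close> from the frame, as \<open>G\<close> is tangential, and the derivative of \<open>G\<close> in the
  direction \<open>quat a p\<close> paired with \<open>quat a p\<close>; summed over the orthonormal frame this is the divergence of
  \<open>G\<close>.  The map \<open>h\<close> stands for the real and the imaginary part.
\<close>

lemma eigenfn_of_sphere_eigenfunction:
  fixes f :: "real ^ 4 \<Rightarrow> complex" and h :: "complex \<Rightarrow> real"
  assumes f: "sphere_eigenfunction (- (of_nat m * (of_nat m + 2))) f" and h: "bounded_linear h"
  shows "eigenfn m (\<lambda>p. h (f p))"
proof -
  interpret h: bounded_linear h by (rule h)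
  define G where "G = sphere_gradient f"
  have df: "f differentiable_on S3" and dG: "G differentiable_on S3"
    and cDf: "\<And>v. continuous_on S3 (\<lambda>p. sphere_differential f p v)"
    and cDG: "\<And>v. continuous_on S3 (\<lambda>p. sphere_differential G p v)"
    and lap: "\<And>p. p \<in> S3 \<Longrightarrow> sphere_divergence G p = - (of_nat m * (of_nat m + 2)) * f p"
    using f by (auto simp: sphere_eigenfunction_def C2_on_sphere_def C1_on_sphere_def G_def laplace_beltrami_def)
  have cf: "continuous_on S3 f" and cG: "continuous_on S3 G"
    using df dG by (auto intro: differentiable_imp_continuous_on)
  have ch: "continuous_on A (\<lambda>x. h (k x))" if "continuous_on A k" for A :: "(real ^ 4) set" and k
    by (rule h.continuous_on[OF that])
  have Df: "sphere_differential f p v = (\<Sum>i\<in>UNIV. v $ i *\<^sub>R G p $ i)" if "p \<in> S3" for p v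
    unfolding sphere_differential_expansion[OF df that, of v] by (simp add: G_def sphere_gradient_def)
  define f1 where "f1 a p = (\<Sum>i\<in>UNIV. quat a p $ i * h (G p $ i))" for a p
  define E where "E k i p = h (sphere_differential G p (axis k 1) $ i)" for k i p
  \<comment> \<open>\<open>E k i\<close> holds the entries of the derivative of \<open>G\<close>; contracting both indices with \<open>quat a p\<close> gives its trace when summed over \<open>a\<close>.\<close>
  define f2 where "f2 a p = (\<Sum>i\<in>UNIV. - p $ i * h (G p $ i) +
     quat a p $ i * (\<Sum>k\<in>UNIV. quat a p $ k * E k i p))" for a p
  have cE: "continuous_on S3 (E k i)" for k i
    unfolding E_def[abs_def] by (intro ch continuous_intros cDG)
  have cf1: "continuous_on S3 (f1 a)" for a
    unfolding f1_def[abs_def] by (intro continuous_intros ch cG)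
  have cf2: "continuous_on S3 (f2 a)" for a
    unfolding f2_def[abs_def] by (intro continuous_intros ch cG cE)
  have d1: "rot_deriv a (\<lambda>p. h (f p)) (f1 a)" for a
    unfolding rot_deriv_def
  proof (intro conjI ballI ch cf cf1)
    fix p assume p: "p \<in> S3"
    have "((\<lambda>t. h (f (rot a t p))) has_vector_derivative h (sphere_differential f p (quat a p))) (at 0)"
      by (rule h.has_vector_derivative[OF rot_has_vector_derivative[OF df p]])
    also have "h (sphere_differential f p (quat a p)) = f1 a p"
      by (simp add: Df[OF p] f1_def h.sum h.scaleR)
    finally show "((\<lambda>t. h (f (rot a t p))) has_real_derivative f1 a p) (at 0)"
      by (simp add: has_real_derivative_iff_has_vector_derivative)
  qed
  have d2: "rot_deriv a (f1 a) (f2 a)" for a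
    unfolding rot_deriv_def
  proof (intro conjI ballI cf1 cf2)
    fix p assume p: "p \<in> S3"
    have q: "((\<lambda>t. quat a (rot a t p) $ i) has_real_derivative - p $ i) (at 0)" for i
      unfolding rot_def linear_add[OF linear_quat] linear_cmul[OF linear_quat]
      by (auto intro!: derivative_eq_intros)
    have hG: "((\<lambda>t. h (G (rot a t p) $ i)) has_real_derivative (\<Sum>k\<in>UNIV. quat a p $ k * E k i p)) (at 0)" for i
    proof -
      have bl: "bounded_linear (\<lambda>z :: complex ^ 4. h (z $ i))"
        by (rule bounded_linear_compose[OF h bounded_linear_vec_nth])
      have "((\<lambda>t. h (G (rot a t p) $ i)) has_vector_derivative h (sphere_differential G p (quat a p) $ i)) (at 0)"
        by (rule bounded_linear.has_vector_derivative[OF bl rot_has_vector_derivative[OF dG p]])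
      also have "h (sphere_differential G p (quat a p) $ i) = (\<Sum>k\<in>UNIV. quat a p $ k * E k i p)"
        unfolding sphere_differential_expansion[OF dG p, of "quat a p"]
        by (simp add: E_def h.sum h.scaleR)
      finally show ?thesis
        by (simp add: has_real_derivative_iff_has_vector_derivative)
    qed
    show "((\<lambda>t. f1 a (rot a t p)) has_real_derivative f2 a p) (at 0)"
      unfolding f1_def f2_def
      by (rule DERIV_sum) (use DERIV_mult[OF q hG] in \<open>simp add: algebra_simps\<close>)
  qed
  have sum_f2: "- (real m * (real m + 2)) * h (f p) = (\<Sum>a\<in>UNIV. f2 a p)" if p: "p \<in> S3" for p
  proof -
    have n1: "(\<Sum>i\<in>UNIV. p $ i * h (G p $ i)) = 0"
      using arg_cong[OF Df[OF p, of p], of h] sphere_differential_normal[OF df p]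
      by (simp add: h.sum h.scaleR h.zero)
    have n2: "(\<Sum>k\<in>UNIV. p $ k * E k i p) = 0" for i
    proof -
      have "(\<Sum>k\<in>UNIV. p $ k * E k i p) = h (sphere_differential G p p $ i)"
        unfolding sphere_differential_expansion[OF dG p, of p] by (simp add: E_def h.sum h.scaleR)
      then show ?thesis by (simp add: sphere_differential_normal[OF dG p] h.zero)
    qed
    have pp: "p \<bullet> p = 1" using p by (simp add: norm_eq_1)
    have "(\<Sum>a\<in>UNIV. f2 a p) = (\<Sum>a\<in>UNIV. \<Sum>i\<in>UNIV. \<Sum>k\<in>UNIV. (quat a p $ i * quat a p $ k) * E k i p)"
      using n1 unfolding f2_def by (simp add: sum.distrib sum_negf sum_subtractf sum_distrib_left mult.assoc)
    also have "\<dots> = (\<Sum>i\<in>UNIV. \<Sum>k\<in>UNIV. (\<Sum>a\<in>UNIV. quat a p $ i * quat a p $ k) * E k i p)"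
      unfolding sum_distrib_right
      by (subst sum.swap, rule sum.cong[OF refl], rule sum.swap)
    also have "\<dots> = (\<Sum>i\<in>UNIV. E i i p - p $ i * (\<Sum>k\<in>UNIV. p $ k * E k i p))"
      unfolding sum_quat_coordinates pp
      by (simp add: left_diff_distrib sum_subtractf sum_distrib_left mult.assoc if_distrib[of "\<lambda>c. c * _"] cong: if_cong)
    also have "\<dots> = (\<Sum>i\<in>UNIV. E i i p)"
      by (simp add: n2)
    also have "\<dots> = h (sphere_divergence G p)"
      by (simp add: sphere_divergence_def E_def h.sum)
    also have "\<dots> = h ((- (real m * (real m + 2))) *\<^sub>R f p)"
      unfolding lap[OF p] by (simp add: scaleR_conv_of_real)
    finally show ?thesis by (simp only: h.scaleR real_scaleR_def)
  qed
  show ?thesis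
    unfolding eigenfn_def has_laplacian_def using d1 d2 sum_f2 by blast
qed

theorem theorem1p1:
  shows "\<exists>C::real. C > 0 \<and>
    (\<forall>(m::nat) (n::nat) (f :: real ^ 4 \<Rightarrow> complex) (g :: real ^ 4 \<Rightarrow> complex).
      m \<ge> n \<longrightarrow>
      sphere_eigenfunction (- (of_nat m * (of_nat m + 2))) f \<longrightarrow>
      sphere_eigenfunction (- (of_nat n * (of_nat n + 2))) g \<longrightarrow>
      L2_norm sphere_measure (\<lambda>x. f x * g x)
        \<le> C * (real n + 1) powr (1 / 2) * L2_norm sphere_measure f * L2_norm sphere_measure g)"
proof (intro exI[of _ 2] conjI allI impI)
  fix m n :: nat and f g :: "real ^ 4 \<Rightarrow> complex"
  assume nm: "m \<ge> n"
    and f: "sphere_eigenfunction (- (of_nat m * (of_nat m + 2))) f"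
    and g: "sphere_eigenfunction (- (of_nat n * (of_nat n + 2))) g"
  have ef: "eigenfn m (\<lambda>p. Re (f p))" "eigenfn m (\<lambda>p. Im (f p))"
    using eigenfn_of_sphere_eigenfunction[OF f] bounded_linear_Re bounded_linear_Im by auto
  have eg: "eigenfn n (\<lambda>p. Re (g p))" "eigenfn n (\<lambda>p. Im (g p))"
    using eigenfn_of_sphere_eigenfunction[OF g] bounded_linear_Re bounded_linear_Im by auto
  note [continuous_intros] = ef[THEN eigenfn_continuous] eg[THEN eigenfn_continuous]
  define A where "A = (LINT x|round_prob. (cmod (f x))\<^sup>2)"
  define B where "B = (LINT x|round_prob. (cmod (g x))\<^sup>2)"
  define X where "X = (LINT x|round_prob. (cmod (f x * g x))\<^sup>2)"
  have A: "A = (LINT x|round_prob. (Re (f x))\<^sup>2) + (LINT x|round_prob. (Im (f x))\<^sup>2)"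
    unfolding A_def cmod_power2
    by (intro Bochner_Integration.integral_add integrable_round_prob continuous_intros)
  have B: "B = (LINT x|round_prob. (Re (g x))\<^sup>2) + (LINT x|round_prob. (Im (g x))\<^sup>2)"
    unfolding B_def cmod_power2
    by (intro Bochner_Integration.integral_add integrable_round_prob continuous_intros)
  have "X = (LINT x|round_prob. (Re (f x))\<^sup>2 * (Re (g x))\<^sup>2 + (Re (f x))\<^sup>2 * (Im (g x))\<^sup>2 +
      ((Im (f x))\<^sup>2 * (Re (g x))\<^sup>2 + (Im (f x))\<^sup>2 * (Im (g x))\<^sup>2))"
    by (simp add: X_def norm_mult power_mult_distrib cmod_power2 ring_distribs add_ac)
  also have "\<dots> = (LINT x|round_prob. (Re (f x))\<^sup>2 * (Re (g x))\<^sup>2) + (LINT x|round_prob. (Re (f x))\<^sup>2 * (Im (g x))\<^sup>2) +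
      ((LINT x|round_prob. (Im (f x))\<^sup>2 * (Re (g x))\<^sup>2) + (LINT x|round_prob. (Im (f x))\<^sup>2 * (Im (g x))\<^sup>2))"
    by (subst Bochner_Integration.integral_add; (intro integrable_round_prob continuous_intros)?)+ simp
  also have "\<dots> \<le> 3 * (real n + 1) * (A * B)"
    using bilinear_real[OF nm ef(1) eg(1)] bilinear_real[OF nm ef(1) eg(2)]
      bilinear_real[OF nm ef(2) eg(1)] bilinear_real[OF nm ef(2) eg(2)]
    unfolding A B by (simp add: ring_distribs)
  finally have X: "X \<le> 3 * (real n + 1) * (A * B)" .
  have A0: "0 \<le> A" and B0: "0 \<le> B" by (simp_all add: A_def B_def)
  have meas: "(\<lambda>x. (cmod (k x))\<^sup>2) \<in> borel_measurable round_prob"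
    if "continuous_on S3 (\<lambda>x. Re (k x))" "continuous_on S3 (\<lambda>x. Im (k x))" for k
    unfolding cmod_power2
    by (intro borel_measurable_integrable integrable_round_prob continuous_intros that)
  have nf: "L2_norm sphere_measure f = sqrt (2 * pi\<^sup>2 * A)"
    unfolding L2_norm_def A_def
    by (intro arg_cong[where f = sqrt] integral_sphere_measure meas continuous_intros)
  have ng: "L2_norm sphere_measure g = sqrt (2 * pi\<^sup>2 * B)"
    unfolding L2_norm_def B_def
    by (intro arg_cong[where f = sqrt] integral_sphere_measure meas continuous_intros)
  have nfg: "L2_norm sphere_measure (\<lambda>x. f x * g x) = sqrt (2 * pi\<^sup>2 * X)"
    unfolding L2_norm_def X_def
    by (intro arg_cong[where f = sqrt] integral_sphere_measure meas) (simp; intro continuous_intros)+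
  have "2 * pi\<^sup>2 \<ge> 1"
    using power_mono[of 2 pi 2] pi_ge_two by simp
  \<comment> \<open>For the unnormalised measure the right-hand side gains a further factor \<open>2 \<pi>\<^sup>2 \<ge> 1\<close>.\<close>
  define Y where "Y = (real n + 1) * (A * B)"
  have "0 \<le> Y" unfolding Y_def using A0 B0 by (intro mult_nonneg_nonneg) auto
  have "X \<le> 3 * Y"
    using X by (simp only: Y_def mult.assoc)
  also have "\<dots> \<le> 4 * Y"
    using \<open>0 \<le> Y\<close> by simp
  also have "4 * Y \<le> 2 * pi\<^sup>2 * (4 * Y)"
    using mult_right_mono[OF \<open>2 * pi\<^sup>2 \<ge> 1\<close>, of "4 * Y"] \<open>0 \<le> Y\<close> by simp
  finally have "2 * pi\<^sup>2 * X \<le> 2 * pi\<^sup>2 * (2 * pi\<^sup>2 * (4 * Y))"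
    by (rule mult_left_mono) simp
  also have "\<dots> = 2\<^sup>2 * (real n + 1) * (2 * pi\<^sup>2 * A) * (2 * pi\<^sup>2 * B)"
    by (simp add: Y_def mult_ac)
  finally have "sqrt (2 * pi\<^sup>2 * X) \<le> sqrt (2\<^sup>2 * (real n + 1) * (2 * pi\<^sup>2 * A) * (2 * pi\<^sup>2 * B))"
    by (rule real_sqrt_le_mono)
  also have "\<dots> = 2 * (real n + 1) powr (1 / 2) * sqrt (2 * pi\<^sup>2 * A) * sqrt (2 * pi\<^sup>2 * B)"
    by (simp only: real_sqrt_mult powr_half_sqrt real_sqrt_abs)
  finally show "L2_norm sphere_measure (\<lambda>x. f x * g x)
        \<le> 2 * (real n + 1) powr (1 / 2) * L2_norm sphere_measure f * L2_norm sphere_measure g"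
    unfolding nf ng nfg .
qed simp

end
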